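(* Let $X=W/\langle f\rangle$ be an intermediary or generic Hopf manifold of dimension $n\ge3$. Then every nonsingular codimension-one holomorphic distribution on $X$ is integrable.
   Context: Let $W=\mathbb C^n\setminus\{0\}$ and $f(z_1,\dots,z_n)=(\mu_1z_1,\dots,\mu_nz_n)$ with $0<|\mu_i|<1$ for all $i$. The compact complex manifold $X=W/\langle f\rangle$ is called a Hopf manifold. Here $\mathbb N$ includes $0$. $X$ is generic if $0<|\mu_1|\le\dots\le|\mu_n|<1$ and there is no non-trivial relation $\prod_{i\in A}\mu_i^{r_i}=\prod_{j\in B}\mu_j^{r_j}$ with $r_i,r_j\in\mathbb N$, $A\cap B=\emptyset$, $A\cup B=\{1,\dots,n\}$ (non-trivial: not all exponents are zero). $X$ is intermediary if $\mu_1=\dots=\mu_r$ for some $2\le r\le n-1$ and there is no non-trivial relation $\prod_{i\in A}\mu_i^{r_i}=\prod_{j\in B}\mu_j^{r_j}$ with $r_i,r_j\in\mathbb N$, $A\cap B=\emptyset$, $A\cup B=\{1,r+1,\dots,n\}$. For $b\in\mathbb C^*$, $L_b$ is the line bundle on $X$ obtained as the quotient of $W\times\mathbb C$ by $(z,v)\mapsto(f(z),bv)$; every line bundle on $X$ is of this form. A nonsingular codimension-one distribution on $X$ is given by an embedding of vector bundles $L_b\to\Omega^1_X$ for some $b$, i.e. a nowhere vanishing section of $\Omega^1_X\otimes L_{b^{-1}}$. Its pullback to $W$ is a nowhere vanishing holomorphic $1$-form $\omega$ on $W$, and the distribution is integrable if $\omega\wedge d\omega=0$. *)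

theory Defs
  imports "HOL-Analysis.Analysis"
begin

section \<open>Hopf manifolds\<close>

text \<open>
  The coordinates of \<open>C^n\<close> are indexed by a finite linearly ordered type with \<open>n\<close> elements; the
  element at position \<open>k\<close> of the order plays the role of the index \<open>k\<close> of \<open>1, ..., n\<close>.
\<close>

definition pos :: "'n::{finite,linorder} \<Rightarrow> nat" where
  "pos i = card {j. j \<le> i}"

definition punctured_space :: "(complex^'n) set" where
  "punctured_space = UNIV - {0}"

definition contraction :: "('n \<Rightarrow> complex) \<Rightarrow> complex^'n \<Rightarrow> complex^'n" where
  "contraction \<mu> z = (\<chi> i. \<mu> i * z $ i)"

definition hopf_multipliers :: "('n \<Rightarrow> complex) \<Rightarrow> bool" where
  "hopf_multipliers \<mu> \<longleftrightarrow> (\<forall>i. 0 < norm (\<mu> i) \<and> norm (\<mu> i) < 1)"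

text \<open>
  For a bijection \<open>F\<close> of \<open>A\<close>, two points are related iff they lie in the same orbit of the
  cyclic group generated by \<open>F\<close> (both directions are listed because \<open>k\<close> is a natural number).
\<close>

definition orbit_rel :: "'a set \<Rightarrow> ('a \<Rightarrow> 'a) \<Rightarrow> ('a \<times> 'a) set" where
  "orbit_rel A F = {(x, y). x \<in> A \<and> y \<in> A \<and> (\<exists>k::nat. (F ^^ k) x = y \<or> (F ^^ k) y = x)}"

lemma orbit_rel_equiv:
  assumes "bij_betw F A A"
  shows "equiv A (orbit_rel A F)"
proof (rule equivI)
  have maps: "(F ^^ k) x \<in> A" if "x \<in> A" for k x
    using that assms by (induction k) (auto simp: bij_betw_def)
  have inj: "x = y" if "x \<in> A" "y \<in> A" "(F ^^ k) x = (F ^^ k) y" for k x y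
    using that
  proof (induction k)
    case (Suc k)
    then have "(F ^^ k) x = (F ^^ k) y"
      using assms maps by (auto simp: bij_betw_def dest: inj_onD)
    with Suc show ?case by blast
  qed simp
  show "orbit_rel A F \<subseteq> A \<times> A" by (auto simp: orbit_rel_def)
  show "refl_on A (orbit_rel A F)"
    by (auto simp: refl_on_def orbit_rel_def intro: exI[of _ 0])
  show "sym (orbit_rel A F)" by (auto simp: sym_def orbit_rel_def)
  have add: "(F ^^ (j + k)) x = (F ^^ j) ((F ^^ k) x)" for j k x
    by (simp add: funpow_add)
  have tr: "\<exists>m. (F ^^ m) u = w \<or> (F ^^ m) w = u"
    if "v \<in> A" "u \<in> A" "w \<in> A" "(F ^^ j) u = (F ^^ k) w" for j k u v w
  proof (cases "j \<le> k")
    case True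
    then have "(F ^^ j) u = (F ^^ j) ((F ^^ (k - j)) w)"
      using that(4) add[of j "k - j"] by simp
    then have "u = (F ^^ (k - j)) w" using inj that maps by blast
    then show ?thesis by metis
  next
    case False
    then have "(F ^^ k) w = (F ^^ k) ((F ^^ (j - k)) u)"
      using that(4) add[of k "j - k"] by simp
    then have "w = (F ^^ (j - k)) u" using inj that maps by blast
    then show ?thesis by metis
  qed
  show "trans (orbit_rel A F)"
  proof (rule transI)
    fix x y z
    assume "(x, y) \<in> orbit_rel A F" "(y, z) \<in> orbit_rel A F"
    then obtain j k where A: "x \<in> A" "y \<in> A" "z \<in> A"
      and jk: "(F ^^ j) x = y \<or> (F ^^ j) y = x" "(F ^^ k) y = z \<or> (F ^^ k) z = y"
      by (auto simp: orbit_rel_def)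
    have "\<exists>p q. (F ^^ p) x = (F ^^ q) z"
      using jk
    proof (elim disjE)
      assume "(F ^^ j) x = y" "(F ^^ k) y = z"
      then have "(F ^^ (k + j)) x = (F ^^ 0) z" by (simp add: add)
      then show ?thesis by blast
    next
      assume "(F ^^ j) x = y" "(F ^^ k) z = y"
      then show ?thesis by metis
    next
      assume "(F ^^ j) y = x" "(F ^^ k) y = z"
      then have "(F ^^ k) x = (F ^^ j) z" by (metis add add.commute)
      then show ?thesis by blast
    next
      assume "(F ^^ j) y = x" "(F ^^ k) z = y"
      then have "(F ^^ 0) x = (F ^^ (j + k)) z" by (simp add: add)
      then show ?thesis by blast
    qed
    then show "(x, z) \<in> orbit_rel A F"
      using tr A by (auto simp: orbit_rel_def)
  qed
qed

definition hopf_manifold :: "('n \<Rightarrow> complex) \<Rightarrow> (complex^'n) set set" where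
  "hopf_manifold \<mu> = punctured_space // orbit_rel punctured_space (contraction \<mu>)"

section \<open>Generic and intermediary Hopf manifolds\<close>

definition no_relation :: "'n set \<Rightarrow> ('n \<Rightarrow> complex) \<Rightarrow> bool" where
  "no_relation S \<mu> \<longleftrightarrow>
    (\<forall>A B (r :: 'n \<Rightarrow> nat).
      A \<inter> B = {} \<longrightarrow> A \<union> B = S \<longrightarrow> (\<Prod>i\<in>A. \<mu> i ^ r i) = (\<Prod>j\<in>B. \<mu> j ^ r j)
        \<longrightarrow> (\<forall>i\<in>S. r i = 0))"

definition generic :: "('n::{finite,linorder} \<Rightarrow> complex) \<Rightarrow> bool" where
  "generic \<mu> \<longleftrightarrow>
    (\<forall>i. 0 < norm (\<mu> i) \<and> norm (\<mu> i) < 1) \<and>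
    (\<forall>i j. i \<le> j \<longrightarrow> norm (\<mu> i) \<le> norm (\<mu> j)) \<and>
    no_relation UNIV \<mu>"

definition intermediary :: "('n::{finite,linorder} \<Rightarrow> complex) \<Rightarrow> bool" where
  "intermediary \<mu> \<longleftrightarrow>
    (\<exists>r. 2 \<le> r \<and> r \<le> CARD('n) - 1 \<and>
      (\<forall>i j. pos i \<le> r \<longrightarrow> pos j \<le> r \<longrightarrow> \<mu> i = \<mu> j) \<and>
      no_relation {i. pos i = 1 \<or> r < pos i} \<mu>)"

section \<open>Line bundles and the cotangent bundle\<close>

text \<open>The line bundle \<open>L_b\<close>, the quotient of \<open>W \<times> C\<close> by \<open>(z, v) \<mapsto> (f z, b v)\<close>.\<close>

definition line_action ::
    "('n \<Rightarrow> complex) \<Rightarrow> complex \<Rightarrow> (complex^'n) \<times> complex \<Rightarrow> (complex^'n) \<times> complex" where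
  "line_action \<mu> b = (\<lambda>(z, v). (contraction \<mu> z, b * v))"

definition line_rel ::
    "('n \<Rightarrow> complex) \<Rightarrow> complex \<Rightarrow> (((complex^'n) \<times> complex) \<times> ((complex^'n) \<times> complex)) set" where
  "line_rel \<mu> b = orbit_rel (punctured_space \<times> UNIV) (line_action \<mu> b)"

definition line_bundle :: "('n \<Rightarrow> complex) \<Rightarrow> complex \<Rightarrow> ((complex^'n) \<times> complex) set set" where
  "line_bundle \<mu> b = (punctured_space \<times> UNIV) // line_rel \<mu> b"

text \<open>
  A covector \<open>\<Sum>i. \<xi> $ i dz_i\<close> of type \<open>(1,0)\<close> at \<open>z\<close> is represented by \<open>(z, \<xi>)\<close>. The map \<open>f\<close> carries
  it to its image under the transpose of the inverse of \<open>df\<close>, that is to \<open>\<Sum>i. (\<xi> $ i / \<mu> i) dz_i\<close>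
  at \<open>f z\<close>; the quotient of \<open>T^*W\<close> by this action is the total space of \<open>\<Omega>^1\<close> of the Hopf manifold.
\<close>

definition cotangent_action ::
    "('n \<Rightarrow> complex) \<Rightarrow> (complex^'n) \<times> (complex^'n) \<Rightarrow> (complex^'n) \<times> (complex^'n)" where
  "cotangent_action \<mu> = (\<lambda>(z, \<xi>). (contraction \<mu> z, \<chi> i. \<xi> $ i / \<mu> i))"

definition cotangent_rel ::
    "('n \<Rightarrow> complex) \<Rightarrow> (((complex^'n) \<times> (complex^'n)) \<times> ((complex^'n) \<times> (complex^'n))) set" where
  "cotangent_rel \<mu> = orbit_rel (punctured_space \<times> UNIV) (cotangent_action \<mu>)"

definition cotangent_bundle :: "('n \<Rightarrow> complex) \<Rightarrow> ((complex^'n) \<times> (complex^'n)) set set" where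
  "cotangent_bundle \<mu> = (punctured_space \<times> UNIV) // cotangent_rel \<mu>"

text \<open>
  The projection of either bundle onto the Hopf manifold: the orbit of \<open>(z, v)\<close> is mapped to its set
  of first components, which is the orbit of \<open>z\<close>.
\<close>

definition bundle_proj :: "('a \<times> 'b) set \<Rightarrow> 'a set" where
  "bundle_proj e = fst ` e"

section \<open>Holomorphic bundle embeddings\<close>

text \<open>
  A map between open subsets of complex vector spaces is holomorphic iff it is Frechet differentiable
  with complex linear derivative. The complex scalar multiplications are explicit arguments.
\<close>

definition holomorphic_map ::
    "(complex \<Rightarrow> 'a \<Rightarrow> 'a) \<Rightarrow> (complex \<Rightarrow> 'b \<Rightarrow> 'b) \<Rightarrow> 'a::real_normed_vector set
      \<Rightarrow> ('a \<Rightarrow> 'b::real_normed_vector) \<Rightarrow> bool" where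
  "holomorphic_map scale1 scale2 U h \<longleftrightarrow>
    (\<forall>x\<in>U. \<exists>D. (h has_derivative D) (at x) \<and> Vector_Spaces.linear scale1 scale2 D)"

abbreviation scale_line :: "complex \<Rightarrow> (complex^'n) \<times> complex \<Rightarrow> (complex^'n) \<times> complex" where
  "scale_line \<equiv> module_prod.scale (*s) (*)"

abbreviation scale_cotangent ::
    "complex \<Rightarrow> (complex^'n) \<times> (complex^'n) \<Rightarrow> (complex^'n) \<times> (complex^'n)" where
  "scale_cotangent \<equiv> module_prod.scale (*s) (*s)"

text \<open>
  The complex structures of the total spaces are those for which the quotient maps are local
  biholomorphisms, so a map between them is holomorphic iff it lifts locally to a holomorphic map.
\<close>

definition holomorphic_bundle_map ::
    "('n \<Rightarrow> complex) \<Rightarrow> complex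
      \<Rightarrow> (((complex^'n::finite) \<times> complex) set \<Rightarrow> ((complex^'n) \<times> (complex^'n)) set) \<Rightarrow> bool" where
  "holomorphic_bundle_map \<mu> b \<Phi> \<longleftrightarrow>
    (\<forall>p\<in>punctured_space \<times> UNIV. \<exists>U h.
      open U \<and> p \<in> U \<and> U \<subseteq> punctured_space \<times> UNIV \<and> h ` U \<subseteq> punctured_space \<times> UNIV \<and>
      holomorphic_map scale_line scale_cotangent U h \<and>
      (\<forall>q\<in>U. \<Phi> (line_rel \<mu> b `` {q}) = cotangent_rel \<mu> `` {h q}))"

text \<open>
  The vector space structure on the fibre over \<open>x\<close> is the one for which, for every representative \<open>z\<close>
  of \<open>x\<close>, mapping \<open>v\<close> to the class of \<open>(z, v)\<close> is a linear isomorphism. It is independent of \<open>z\<close>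
  since the bundle actions are linear on fibres.
\<close>

definition bundle_embedding ::
    "('n \<Rightarrow> complex) \<Rightarrow> complex
      \<Rightarrow> (((complex^'n::finite) \<times> complex) set \<Rightarrow> ((complex^'n) \<times> (complex^'n)) set) \<Rightarrow> bool" where
  "bundle_embedding \<mu> b \<Phi> \<longleftrightarrow>
    (\<forall>e\<in>line_bundle \<mu> b. \<Phi> e \<in> cotangent_bundle \<mu> \<and> bundle_proj (\<Phi> e) = bundle_proj e) \<and>
    holomorphic_bundle_map \<mu> b \<Phi> \<and>
    (\<forall>x\<in>hopf_manifold \<mu>. \<forall>z\<in>x. \<exists>\<phi>.
      Vector_Spaces.linear (*) (*s) \<phi> \<and> inj \<phi> \<and>
      (\<forall>v. \<Phi> (line_rel \<mu> b `` {(z, v)}) = cotangent_rel \<mu> `` {(z, \<phi> v)}))"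

definition nonsingular_distribution ::
    "('n \<Rightarrow> complex) \<Rightarrow> complex
      \<Rightarrow> (((complex^'n::finite) \<times> complex) set \<Rightarrow> ((complex^'n) \<times> (complex^'n)) set) \<Rightarrow> bool" where
  "nonsingular_distribution \<mu> b \<Phi> \<longleftrightarrow> b \<noteq> 0 \<and> bundle_embedding \<mu> b \<Phi>"

section \<open>Integrability\<close>

text \<open>
  The pullback of \<open>L_b\<close> to \<open>W\<close> is trivialised by \<open>z \<mapsto> (z, 1)\<close>; the image of this section is the
  pulled back 1-form, here given by its vector of coefficients with respect to \<open>dz_1, ..., dz_n\<close>.
  The coefficients exist and are unique because \<open>f\<close> acts freely on \<open>W\<close>.
\<close>

definition pullback_coeffs ::
    "('n \<Rightarrow> complex) \<Rightarrow> complex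
      \<Rightarrow> (((complex^'n::finite) \<times> complex) set \<Rightarrow> ((complex^'n) \<times> (complex^'n)) set)
      \<Rightarrow> complex^'n \<Rightarrow> complex^'n" where
  "pullback_coeffs \<mu> b \<Phi> z =
    (THE \<xi>. \<Phi> (line_rel \<mu> b `` {(z, 1)}) = cotangent_rel \<mu> `` {(z, \<xi>)})"

lemma cotangent_class_unique:
  assumes "hopf_multipliers \<mu>" "z \<in> punctured_space"
    and "cotangent_rel \<mu> `` {(z, \<xi>)} = cotangent_rel \<mu> `` {(z, \<eta>)}"
  shows "\<xi> = \<eta>"
proof -
  have "(z, \<eta>) \<in> cotangent_rel \<mu> `` {(z, \<eta>)}"
    using assms(2) by (auto simp: cotangent_rel_def orbit_rel_def intro: exI[of _ 0])
  then have "((z, \<xi>), (z, \<eta>)) \<in> cotangent_rel \<mu>" using assms(3) by blast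
  then obtain k where k: "(cotangent_action \<mu> ^^ k) (z, \<xi>) = (z, \<eta>)
      \<or> (cotangent_action \<mu> ^^ k) (z, \<eta>) = (z, \<xi>)"
    by (auto simp: cotangent_rel_def orbit_rel_def)
  have iter: "fst ((cotangent_action \<mu> ^^ k) (z, \<zeta>)) $ i = \<mu> i ^ k * z $ i" for \<zeta> k i
    by (induction k) (auto simp: cotangent_action_def contraction_def split: prod.splits)
  obtain i where i: "z $ i \<noteq> 0"
    using assms(2) by (auto simp: punctured_space_def vec_eq_iff)
  have "\<mu> i ^ k * z $ i = z $ i" using k iter by (metis fst_conv)
  then have "norm (\<mu> i) ^ k = 1" using i by (simp flip: norm_power)
  then have "k = 0"
    using assms(1) power_strict_decreasing[of 0 k "norm (\<mu> i)"]
    by (cases "k = 0") (auto simp: hopf_multipliers_def)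
  then show ?thesis using k by auto
qed

definition form_of_coeffs :: "(complex^'n \<Rightarrow> complex^'n) \<Rightarrow> complex^'n \<Rightarrow> complex^'n \<Rightarrow> complex" where
  "form_of_coeffs w z u = (\<Sum>i\<in>UNIV. w z $ i * u $ i)"

definition ext_deriv ::
    "(complex^'n \<Rightarrow> complex^'n \<Rightarrow> complex) \<Rightarrow> complex^'n \<Rightarrow> complex^'n \<Rightarrow> complex^'n \<Rightarrow> complex" where
  "ext_deriv \<omega> z u v =
    frechet_derivative (\<lambda>x. \<omega> x v) (at z) u - frechet_derivative (\<lambda>x. \<omega> x u) (at z) v"

definition wedge_1_2 ::
    "('v \<Rightarrow> complex) \<Rightarrow> ('v \<Rightarrow> 'v \<Rightarrow> complex) \<Rightarrow> 'v \<Rightarrow> 'v \<Rightarrow> 'v \<Rightarrow> complex" where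
  "wedge_1_2 \<alpha> \<beta> u v w = \<alpha> u * \<beta> v w + \<alpha> v * \<beta> w u + \<alpha> w * \<beta> u v"

definition integrable_distribution ::
    "('n \<Rightarrow> complex) \<Rightarrow> complex
      \<Rightarrow> (((complex^'n::finite) \<times> complex) set \<Rightarrow> ((complex^'n) \<times> (complex^'n)) set) \<Rightarrow> bool" where
  "integrable_distribution \<mu> b \<Phi> \<longleftrightarrow>
    (let \<omega> = form_of_coeffs (pullback_coeffs \<mu> b \<Phi>)
     in \<forall>z\<in>punctured_space. \<forall>u v w. wedge_1_2 (\<omega> z) (ext_deriv \<omega> z) u v w = 0)"

end

theory Submission
  imports Defs "HOL-Complex_Analysis.Conformal_Mappings"
begin

text \<open>
  A distribution on the Hopf manifold is, on \<open>W\<close>, a nowhere vanishing form \<open>\<Sum>i. g i dz_i\<close> whose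
  coefficients satisfy \<open>g i (f z) = (c / \<mu> i) * g i z\<close> with \<open>c = 1 / b\<close>. The theorem holds because such a
  form must have constant coefficients, so that it is closed. Formally, \<open>g i\<close> is a combination of the
  monomials \<open>z^\<alpha>\<close> with \<open>\<mu>^\<alpha> * \<mu> i = c\<close>, and there are very few of them: nonvanishing on the coordinate
  axes forces \<open>c = \<mu> j ^ k * \<mu> i\<close> for every \<open>j\<close> (with \<open>k\<close> and \<open>i\<close> depending on \<open>j\<close>), and the absence of
  multiplicative relations then leaves only two possibilities, \<open>c = \<mu> p\<close> for some \<open>p\<close>, or \<open>c = \<mu> i * \<mu> s\<close>
  where all indices except \<open>s\<close> have the multiplier \<open>\<mu> i\<close>
  (lemma \<open>conormal_multiplier_cases\<close>).

  In the first case \<open>\<mu>^\<alpha> * \<mu> i = \<mu> p\<close> only for \<open>\<alpha> = 0\<close>, so the coefficients are constant. In the second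
  case the form would be \<open>z_s dL + M dz_s\<close> with linear forms \<open>L\<close> and \<open>M\<close> in the \<open>n - 1 \<ge> 2\<close> variables other
  than \<open>z_s\<close>, and it would vanish at a zero of \<open>M\<close> on the hyperplane \<open>z_s = 0\<close>
  (lemma \<open>semi_invariant_coefficients_locally_constant\<close>).

  The proof replaces Hartogs extension and power series in several variables by differentiation. If
  \<open>G (f z) = \<rho> * G z\<close>, then the partial derivative in direction \<open>j\<close> has factor \<open>\<rho> / \<mu> j\<close>, which is larger in
  norm. After finitely many derivatives the factor has norm above 1, and then the function vanishes:
  by the maximum principle on a complex line that avoids the origin it is bounded near the origin,
  where the contraction accumulates. Integrating back, \<open>G\<close> vanishes as soon as \<open>\<rho>\<close> is not a monomial in
  the multipliers. The same argument works inside each coordinate subspace (lemma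
  \<open>semi_invariant_eq_0_on_coordinate_subspace\<close>), and it carries the whole analytic part.
\<close>

section \<open>Functions holomorphic on complex lines\<close>

text \<open>
  Continuity together with holomorphy along every complex line is the form of holomorphy in several
  variables used here: unlike complex Frechet differentiability, it passes to directional derivatives
  by arguments in one variable.
\<close>

definition holomorphic_on_lines :: "(complex^'n) set \<Rightarrow> (complex^'n \<Rightarrow> complex) \<Rightarrow> bool" where
  "holomorphic_on_lines U G \<longleftrightarrow>
    continuous_on U G \<and> (\<forall>z u. (\<lambda>\<zeta>. G (z + \<zeta> *s u)) holomorphic_on {\<zeta>. z + \<zeta> *s u \<in> U})"

definition dir_deriv :: "complex^'n \<Rightarrow> (complex^'n \<Rightarrow> complex) \<Rightarrow> complex^'n \<Rightarrow> complex" where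
  "dir_deriv u G z = deriv (\<lambda>\<zeta>. G (z + \<zeta> *s u)) 0"

lemma norm_vector_scale: "norm (c *s x) = norm c * norm x" for x :: "complex^'n"
  by (simp add: norm_vec_def norm_mult L2_set_right_distrib)

lemma continuous_on_complex_line [continuous_intros]:
  fixes u :: "complex^'n"
  assumes "continuous_on A f" "continuous_on A g"
  shows "continuous_on A (\<lambda>\<zeta>. f \<zeta> + g \<zeta> *s u)"
proof -
  have "continuous_on A (\<lambda>\<zeta>. f \<zeta> + (\<chi> i. g \<zeta> * u $ i))"
    using assms by (intro continuous_intros)
  then show ?thesis by (simp add: vector_scalar_mult_def)
qed

lemma open_line_preimage:
  fixes u :: "complex^'n"
  assumes "open U" shows "open {\<zeta>. z + \<zeta> *s u \<in> U}"
proof -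
  have "open ((\<lambda>\<zeta>. z + \<zeta> *s u) -` U)"
    by (intro open_vimage assms continuous_intros)
  then show ?thesis by (simp add: vimage_def)
qed

text \<open>
  The error is governed by the second derivative, which the Cauchy inequality bounds on the disc of
  radius \<open>r / 2\<close>. The constant depends only on \<open>M\<close> and \<open>r\<close>; this makes the convergence of difference
  quotients of a family of functions uniform.
\<close>

lemma difference_quotient_error:
  fixes f :: "complex \<Rightarrow> complex"
  assumes hol: "f holomorphic_on cball 0 r" and r: "r > 0"
    and M: "\<And>\<zeta>. \<zeta> \<in> cball 0 r \<Longrightarrow> norm (f \<zeta>) \<le> M"
    and t: "t \<noteq> 0" "norm t \<le> r / 2"
  shows "norm ((f t - f 0) / t - deriv f 0) \<le> 8 * M / r\<^sup>2 * norm t"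
proof -
  have holb: "f holomorphic_on ball 0 r"
    using hol holomorphic_on_subset by force
  have second: "norm ((deriv ^^ 2) f \<xi>) \<le> 8 * M / r\<^sup>2" if "\<xi> \<in> cball 0 (r/2)" for \<xi>
  proof -
    have sub: "cball \<xi> (r/2) \<subseteq> cball 0 r"
      using that by (intro cball_subset_cball_iff[THEN iffD2]) (auto simp: dist_norm)
    have "norm ((deriv ^^ 2) f \<xi>) \<le> fact 2 * M / (r/2)^2"
    proof (rule Cauchy_inequality)
      show "f holomorphic_on ball \<xi> (r/2)"
        using sub hol holomorphic_on_subset ball_subset_cball by (metis order_trans)
      show "continuous_on (cball \<xi> (r/2)) f"
        using sub hol holomorphic_on_imp_continuous_on continuous_on_subset by blast
      show "r/2 > 0" using r by simp
      show "norm (f x) \<le> M" if "norm (\<xi> - x) = r/2" for x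
        using that sub by (intro M) (auto simp: dist_norm)
    qed
    then show ?thesis by (simp add: power2_eq_square field_simps)
  qed
  have "norm ((deriv ^^ 0) f t - (\<Sum>i\<le>1. (deriv ^^ i) f 0 * (t-0) ^ i / fact i))
          \<le> 8 * M / r\<^sup>2 * norm (t - 0) ^ Suc 1 / fact 1"
  proof (rule field_Taylor[where S = "cball 0 (r/2)"])
    show "convex (cball (0::complex) (r/2))" by simp
    show "((deriv ^^ i) f has_field_derivative (deriv ^^ Suc i) f x) (at x within cball 0 (r/2))"
      if "x \<in> cball 0 (r/2)" for i x
    proof -
      have "(deriv ^^ i) f holomorphic_on ball 0 r"
        by (rule holomorphic_higher_deriv[OF holb]) simp
      then have "((deriv ^^ i) f has_field_derivative deriv ((deriv ^^ i) f) x) (at x)"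
        using that r by (intro holomorphic_derivI[of _ "ball 0 r"]) auto
      then show ?thesis by (simp add: has_field_derivative_at_within)
    qed
    show "norm ((deriv ^^ Suc 1) f x) \<le> 8 * M / r\<^sup>2" if "x \<in> cball 0 (r/2)" for x
      using second[OF that] by (simp add: numeral_2_eq_2)
  qed (use t r in auto)
  then have "norm (f t - f 0 - deriv f 0 * t) \<le> 8 * M / r\<^sup>2 * norm t ^ 2"
    by (simp add: numeral_2_eq_2 algebra_simps)
  moreover have "(f t - f 0) / t - deriv f 0 = (f t - f 0 - deriv f 0 * t) / t"
    using t by (simp add: field_simps)
  ultimately show ?thesis
    using t by (simp add: norm_divide divide_le_eq power2_eq_square algebra_simps)
qed

text \<open>
  A directional derivative is locally a uniform limit of difference quotients, because \<open>G\<close> is bounded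
  on compact neighbourhoods. A sequence of increments \<open>t k\<close> is used since limits of holomorphic functions
  are taken along sequences.
\<close>

lemma dir_deriv_uniform_limit:
  fixes G :: "complex^'n \<Rightarrow> complex"
  assumes U: "open U" and G: "holomorphic_on_lines U G" and z0: "z0 \<in> U"
  obtains \<delta> and t :: "nat \<Rightarrow> complex"
  where "\<delta> > 0" "ball z0 \<delta> \<subseteq> U" "\<And>k x. x \<in> ball z0 \<delta> \<Longrightarrow> x + t k *s u \<in> U"
    "uniform_limit (ball z0 \<delta>) (\<lambda>k x. (G (x + t k *s u) - G x) / t k) (dir_deriv u G) sequentially"
proof -
  obtain R where R: "R > 0" "cball z0 R \<subseteq> U"
    using U z0 open_contains_cball by blast
  have cont: "continuous_on U G" using G by (simp add: holomorphic_on_lines_def)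
  have "compact (G ` cball z0 R)"
    using cont R by (intro compact_continuous_image) (auto intro: continuous_on_subset)
  then have "bounded (G ` cball z0 R)" by (rule compact_imp_bounded)
  then obtain M where M: "\<And>x. x \<in> cball z0 R \<Longrightarrow> norm (G x) \<le> M"
    unfolding bounded_iff by blast
  \<comment> \<open>small enough that \<open>x + \<zeta> *s u\<close> stays in \<open>cball z0 R\<close> for \<open>x \<in> ball z0 (R/2)\<close> and \<open>norm \<zeta> \<le> r\<close>\<close>
  define r where "r = R / (2 * (1 + norm u))"
  have r: "r > 0" using R by (simp add: r_def add_pos_nonneg)
  have ru: "r * norm u \<le> R / 2"
    using R by (simp add: r_def field_simps add_pos_nonneg)
  have inR: "x + \<zeta> *s u \<in> cball z0 R" if "x \<in> ball z0 (R/2)" "\<zeta> \<in> cball 0 r" for x \<zeta>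
  proof -
    have "norm (\<zeta> *s u) \<le> r * norm u"
      using that by (auto simp: norm_vector_scale intro: mult_right_mono)
    then have "norm (x - z0) + norm (\<zeta> *s u) \<le> R"
      using that ru by (simp add: dist_norm norm_minus_commute)
    moreover have "dist z0 (x + \<zeta> *s u) \<le> norm (x - z0) + norm (\<zeta> *s u)"
      using norm_triangle_ineq[of "x - z0" "\<zeta> *s u"] norm_minus_commute[of z0 "x + \<zeta> *s u"]
      by (simp add: dist_norm algebra_simps)
    ultimately show ?thesis by simp
  qed
  define t where "t = (\<lambda>k. complex_of_real (r / (2 * real (Suc k))))"
  have nt: "norm (t k) = r / (2 * real (Suc k))" for k
    using r unfolding t_def norm_of_real by simp
  have t: "t k \<noteq> 0" "norm (t k) \<le> r / 2" for k
  proof -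
    show "norm (t k) \<le> r / 2"
      unfolding nt using r by (simp add: field_simps)
    show "t k \<noteq> 0" using nt[of k] r by (auto simp del: of_nat_Suc)
  qed
  have err: "norm ((G (x + t k *s u) - G x) / t k - dir_deriv u G x) \<le> 8 * M / r\<^sup>2 * norm (t k)"
    if x: "x \<in> ball z0 (R/2)" for x k
  proof -
    have "(\<lambda>\<zeta>. G (x + \<zeta> *s u)) holomorphic_on cball 0 r"
      using G inR[OF x] R(2)
      by (auto simp: holomorphic_on_lines_def intro!: holomorphic_on_subset[where t = "cball 0 r"])
    from difference_quotient_error[OF this r _ t] M inR[OF x]
    show ?thesis by (simp add: dir_deriv_def)
  qed
  have lim: "uniform_limit (ball z0 (R/2)) (\<lambda>k x. (G (x + t k *s u) - G x) / t k)
      (dir_deriv u G) sequentially"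
  proof (rule uniform_limitI)
    fix e :: real assume "e > 0"
    have "(\<lambda>k. 8 * M / r\<^sup>2 * norm (t k)) \<longlonglongrightarrow> 8 * M / r\<^sup>2 * 0"
    proof (rule tendsto_mult_left)
      have "(\<lambda>k. r / 2 * inverse (real (Suc k))) \<longlonglongrightarrow> r / 2 * 0"
        by (intro tendsto_mult_left LIMSEQ_inverse_real_of_nat)
      then show "(\<lambda>k. norm (t k)) \<longlonglongrightarrow> 0"
        unfolding nt by (simp add: field_simps)
    qed
    then have "\<forall>\<^sub>F k in sequentially. 8 * M / r\<^sup>2 * norm (t k) < e"
      using \<open>e > 0\<close> by (intro order_tendstoD(2)[where y = 0]) auto
    then show "\<forall>\<^sub>F k in sequentially. \<forall>x\<in>ball z0 (R/2).
        dist ((G (x + t k *s u) - G x) / t k) (dir_deriv u G x) < e"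
    proof eventually_elim
      case (elim k)
      then show ?case using err le_less_trans unfolding dist_norm by blast
    qed
  qed
  show thesis
  proof (rule that)
    show "R/2 > 0" using R by simp
    show "ball z0 (R/2) \<subseteq> U" using R by (auto simp: subset_iff)
    show "x + t k *s u \<in> U" if "x \<in> ball z0 (R/2)" for k x
      using inR[OF that, of "t k"] t(2)[of k] r R(2) by (auto simp: subset_iff)
  qed (rule lim)
qed

text \<open>
  Both continuity and holomorphy along a line in any direction \<open>v\<close> pass from the difference quotients
  in direction \<open>u\<close> to their locally uniform limit.
\<close>

lemma holomorphic_on_lines_dir_deriv:
  fixes G :: "complex^'n \<Rightarrow> complex"
  assumes U: "open U" and G: "holomorphic_on_lines U G"
  shows "holomorphic_on_lines U (dir_deriv u G)"
  unfolding holomorphic_on_lines_def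
proof (intro conjI allI)
  have cont: "continuous_on U G" using G by (simp add: holomorphic_on_lines_def)
  have quotient_cont: "continuous_on A (\<lambda>x. (G (x + t *s u) - G x) / t)"
    if "A \<subseteq> U" "\<And>x. x \<in> A \<Longrightarrow> x + t *s u \<in> U" for A t
    using that unfolding divide_inverse
    by (auto intro!: continuous_intros continuous_on_compose2[OF cont])
  show "continuous_on U (dir_deriv u G)"
  proof (rule continuous_at_imp_continuous_on, rule ballI)
    fix z0 assume "z0 \<in> U"
    obtain \<delta> t where \<delta>: "\<delta> > 0" "ball z0 \<delta> \<subseteq> U" "\<And>k x. x \<in> ball z0 \<delta> \<Longrightarrow> x + t k *s u \<in> U"
      "uniform_limit (ball z0 \<delta>) (\<lambda>k x. (G (x + t k *s u) - G x) / t k) (dir_deriv u G) sequentially"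
      by (rule dir_deriv_uniform_limit[where u = u, OF U G \<open>z0 \<in> U\<close>]) (rule that)
    have "continuous_on (ball z0 \<delta>) (dir_deriv u G)"
      using \<delta> by (intro uniform_limit_theorem[OF _ \<delta>(4)] always_eventually allI quotient_cont) auto
    then show "isCont (dir_deriv u G) z0"
      using \<delta>(1) by (simp add: continuous_on_eq_continuous_at)
  qed
  fix z v
  define S where "S = {\<zeta>. z + \<zeta> *s v \<in> U}"
  have S: "open S" unfolding S_def by (rule open_line_preimage[OF U])
  have "(\<lambda>\<zeta>. dir_deriv u G (z + \<zeta> *s v)) holomorphic_on S"
    unfolding holomorphic_on_def
  proof (intro ballI)
    fix \<zeta>0 assume "\<zeta>0 \<in> S"
    then have in_U: "z + \<zeta>0 *s v \<in> U" by (simp add: S_def)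
    obtain \<delta> t where \<delta>: "\<delta> > 0" "ball (z + \<zeta>0 *s v) \<delta> \<subseteq> U"
      "\<And>k x. x \<in> ball (z + \<zeta>0 *s v) \<delta> \<Longrightarrow> x + t k *s u \<in> U"
      "uniform_limit (ball (z + \<zeta>0 *s v) \<delta>) (\<lambda>k x. (G (x + t k *s u) - G x) / t k)
        (dir_deriv u G) sequentially"
      by (rule dir_deriv_uniform_limit[where u = u, OF U G in_U]) (rule that)
    define B where "B = {\<zeta>. z + \<zeta> *s v \<in> ball (z + \<zeta>0 *s v) \<delta>}"
    have B: "open B" "\<zeta>0 \<in> B"
    proof -
      show "open B" unfolding B_def by (rule open_line_preimage) simp
      show "\<zeta>0 \<in> B" using \<delta>(1) by (simp add: B_def)
    qed
    have hol: "(\<lambda>\<zeta>. (G (z + \<zeta> *s v + t k *s u) - G (z + \<zeta> *s v)) / t k) holomorphic_on B" for k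
    proof -
      have "(\<lambda>\<zeta>. G ((z + t k *s u) + \<zeta> *s v)) holomorphic_on {\<zeta>. (z + t k *s u) + \<zeta> *s v \<in> U}"
        "(\<lambda>\<zeta>. G (z + \<zeta> *s v)) holomorphic_on {\<zeta>. z + \<zeta> *s v \<in> U}"
        using G by (auto simp: holomorphic_on_lines_def)
      moreover have "B \<subseteq> {\<zeta>. (z + t k *s u) + \<zeta> *s v \<in> U}"
        using \<delta>(3)[of "z + _ *s v" k] by (auto simp: B_def add_ac)
      moreover have "B \<subseteq> {\<zeta>. z + \<zeta> *s v \<in> U}"
        using \<delta>(2) by (auto simp: B_def)
      ultimately have "(\<lambda>\<zeta>. G ((z + t k *s u) + \<zeta> *s v)) holomorphic_on B"
        "(\<lambda>\<zeta>. G (z + \<zeta> *s v)) holomorphic_on B"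
        by (blast intro: holomorphic_on_subset)+
      then show ?thesis
        unfolding divide_inverse by (intro holomorphic_intros) (auto simp: add_ac)
    qed
    have "(\<lambda>\<zeta>. dir_deriv u G (z + \<zeta> *s v)) holomorphic_on B"
    proof (rule holomorphic_uniform_sequence[OF B(1) hol])
      fix x assume "x \<in> B"
      then obtain d where d: "d > 0" "cball x d \<subseteq> B"
        using B(1) open_contains_cball by blast
      have "uniform_limit (cball x d)
        (\<lambda>k \<zeta>. (G (z + \<zeta> *s v + t k *s u) - G (z + \<zeta> *s v)) / t k)
        (\<lambda>\<zeta>. dir_deriv u G (z + \<zeta> *s v)) sequentially"
        by (rule uniform_limit_compose'[OF \<delta>(4)]) (use d in \<open>auto simp: B_def\<close>)
      with d show "\<exists>d. 0 < d \<and> cball x d \<subseteq> B \<and> uniform_limit (cball x d)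
        (\<lambda>k \<zeta>. (G (z + \<zeta> *s v + t k *s u) - G (z + \<zeta> *s v)) / t k)
        (\<lambda>\<zeta>. dir_deriv u G (z + \<zeta> *s v)) sequentially" by blast
    qed
    then show "(\<lambda>\<zeta>. dir_deriv u G (z + \<zeta> *s v)) field_differentiable at \<zeta>0 within S"
      using B holomorphic_on_imp_differentiable_at field_differentiable_at_within by blast
  qed
  then show "(\<lambda>\<zeta>. dir_deriv u G (z + \<zeta> *s v)) holomorphic_on {\<zeta>. z + \<zeta> *s v \<in> U}"
    by (simp add: S_def)
qed

lemma has_field_derivative_line:
  fixes G :: "complex^'n \<Rightarrow> complex"
  assumes U: "open U" and G: "holomorphic_on_lines U G" and z: "z + \<zeta> *s u \<in> U"
  shows "((\<lambda>\<zeta>. G (z + \<zeta> *s u)) has_field_derivative dir_deriv u G (z + \<zeta> *s u)) (at \<zeta>)"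
proof -
  have "(\<lambda>\<zeta>'. G ((z + \<zeta> *s u) + \<zeta>' *s u)) holomorphic_on {\<zeta>'. (z + \<zeta> *s u) + \<zeta>' *s u \<in> U}"
    using G by (auto simp: holomorphic_on_lines_def)
  then have "((\<lambda>\<zeta>'. G ((z + \<zeta> *s u) + \<zeta>' *s u)) has_field_derivative dir_deriv u G (z + \<zeta> *s u)) (at 0)"
    unfolding dir_deriv_def
    by (rule holomorphic_derivI) (use z in \<open>auto intro: open_line_preimage[OF U]\<close>)
  also have "(\<lambda>\<zeta>'. G ((z + \<zeta> *s u) + \<zeta>' *s u)) = (\<lambda>\<zeta>'. G (z + (\<zeta>' + \<zeta>) *s u))"
    by (simp add: vector_sadd_rdistrib add_ac)
  finally show ?thesis
    using DERIV_shift[of "\<lambda>\<zeta>. G (z + \<zeta> *s u)" _ 0 \<zeta>] by simp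
qed

section \<open>Semi-invariant functions\<close>

definition semi_invariant :: "('n \<Rightarrow> complex) \<Rightarrow> complex \<Rightarrow> (complex^'n \<Rightarrow> complex) \<Rightarrow> bool" where
  "semi_invariant \<mu> \<rho> G \<longleftrightarrow> (\<forall>z\<in>punctured_space. G (contraction \<mu> z) = \<rho> * G z)"

lemma open_punctured_space: "open (punctured_space :: (complex^'n) set)"
  unfolding punctured_space_def by (intro open_Diff) auto

lemma mem_punctured_space_iff: "z \<in> punctured_space \<longleftrightarrow> (\<exists>i. z $ i \<noteq> 0)"
  by (simp add: punctured_space_def vec_eq_iff)

lemma contraction_mem_punctured_space:
  assumes "\<forall>i. \<mu> i \<noteq> 0" "z \<in> punctured_space"
  shows "contraction \<mu> z \<in> punctured_space"
  using assms by (auto simp: mem_punctured_space_iff contraction_def)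

text \<open>
  Differentiating \<open>G (f z) = \<rho> * G z\<close> in \<open>z_j\<close> produces an additional factor \<open>\<mu> j\<close> on the left, by the chain rule.
  For a contraction and \<open>\<rho> \<noteq> 0\<close> the new factor \<open>\<rho> / \<mu> j\<close> is strictly larger in norm, so that repeated
  differentiation leads to factors of norm above 1.
\<close>

lemma semi_invariant_dir_deriv:
  fixes G :: "complex^'n \<Rightarrow> complex"
  assumes \<mu>: "\<forall>i. \<mu> i \<noteq> 0" and G: "holomorphic_on_lines punctured_space G"
    and inv: "semi_invariant \<mu> \<rho> G"
  shows "semi_invariant \<mu> (\<rho> / \<mu> j) (dir_deriv (axis j 1) G)"
  unfolding semi_invariant_def
proof
  fix z :: "complex^'n" assume z: "z \<in> punctured_space"
  have step: "contraction \<mu> (z + \<zeta> *s axis j 1) = contraction \<mu> z + (\<mu> j * \<zeta>) *s axis j 1" for \<zeta>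
    by (simp add: contraction_def vec_eq_iff axis_def algebra_simps)
  define S where "S = {\<zeta>. z + \<zeta> *s axis j 1 \<in> punctured_space}"
  have S: "open S" "0 \<in> S"
    unfolding S_def using open_line_preimage[OF open_punctured_space] z by auto
  have fz: "contraction \<mu> z + 0 *s axis j 1 \<in> punctured_space"
    using contraction_mem_punctured_space[OF \<mu> z] by simp
  have "((\<lambda>\<zeta>. G (contraction \<mu> z + \<zeta> *s axis j 1)) has_field_derivative
      dir_deriv (axis j 1) G (contraction \<mu> z)) (at (\<mu> j * 0))"
    using has_field_derivative_line[OF open_punctured_space G fz] by simp
  then have "((\<lambda>\<zeta>. G (contraction \<mu> z + (\<mu> j * \<zeta>) *s axis j 1)) has_field_derivative
      dir_deriv (axis j 1) G (contraction \<mu> z) * \<mu> j) (at 0)"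
    by (rule DERIV_chain2) (auto intro!: derivative_eq_intros)
  moreover have "((\<lambda>\<zeta>. G (contraction \<mu> z + (\<mu> j * \<zeta>) *s axis j 1)) has_field_derivative
      \<rho> * dir_deriv (axis j 1) G z) (at 0)"
  proof (rule has_field_derivative_transform_within_open[OF _ S])
    show "((\<lambda>\<zeta>. \<rho> * G (z + \<zeta> *s axis j 1)) has_field_derivative \<rho> * dir_deriv (axis j 1) G z) (at 0)"
      using has_field_derivative_line[OF open_punctured_space G, of z 0 "axis j 1"] z
      by (intro DERIV_cmult) simp
    show "\<rho> * G (z + \<zeta> *s axis j 1) = G (contraction \<mu> z + (\<mu> j * \<zeta>) *s axis j 1)" if "\<zeta> \<in> S" for \<zeta>
      using that inv by (simp add: S_def semi_invariant_def flip: step)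
  qed
  ultimately have "dir_deriv (axis j 1) G (contraction \<mu> z) * \<mu> j = \<rho> * dir_deriv (axis j 1) G z"
    by (rule DERIV_unique)
  then show "dir_deriv (axis j 1) G (contraction \<mu> z) = \<rho> / \<mu> j * dir_deriv (axis j 1) G z"
    using \<mu> by (simp add: field_simps)
qed

text \<open>
  In dimension at least 2 the origin is not an obstacle for the maximum principle: through each \<open>w\<close> in the
  unit ball there is a complex line that avoids the origin, and the circle of radius 2 about \<open>w\<close> in this
  line lies in the compact shell between radii 1 and 3. This takes the place of Hartogs extension.
\<close>

lemma bounded_near_puncture:
  fixes G :: "complex^'n \<Rightarrow> complex"
  assumes n: "CARD('n) \<ge> 2" and G: "holomorphic_on_lines punctured_space G"
  shows "\<exists>K. \<forall>w\<in>punctured_space. norm w \<le> 1 \<longrightarrow> norm (G w) \<le> K"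
proof -
  define S where "S = {x :: complex^'n. 1 \<le> norm x \<and> norm x \<le> 3}"
  have "S = cball 0 3 - ball 0 1" by (auto simp: S_def)
  then have "compact S" by (simp add: compact_diff)
  moreover have "S \<subseteq> punctured_space" by (auto simp: S_def punctured_space_def)
  ultimately have "compact (G ` S)"
    using G by (intro compact_continuous_image)
      (auto simp: holomorphic_on_lines_def intro: continuous_on_subset)
  then have "bounded (G ` S)" by (rule compact_imp_bounded)
  then obtain K where K: "\<And>x. x \<in> S \<Longrightarrow> norm (G x) \<le> K"
    unfolding bounded_iff by blast
  have "norm (G w) \<le> K" if w: "w \<in> punctured_space" "norm w \<le> 1" for w
  proof -
    obtain i where i: "w $ i \<noteq> 0" using w by (auto simp: mem_punctured_space_iff)
    have "\<exists>j. j \<noteq> i"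
    proof (rule ccontr)
      assume "\<not> ?thesis"
      then have "UNIV = {i}" by auto
      then have "CARD('n) = 1" by (metis card.empty card_insert_disjoint finite.emptyI
        insert_absorb insert_not_empty One_nat_def)
      with n show False by simp
    qed
    then obtain j where j: "j \<noteq> i" by blast
    have line: "w + \<zeta> *s axis j 1 \<in> punctured_space" for \<zeta>
      using i j by (auto simp: mem_punctured_space_iff axis_def intro!: exI[of _ i])
    have hol: "(\<lambda>\<zeta>. G (w + \<zeta> *s axis j 1)) holomorphic_on UNIV"
    proof -
      have "{\<zeta>. w + \<zeta> *s axis j 1 \<in> punctured_space} = UNIV" using line by auto
      then show ?thesis using G unfolding holomorphic_on_lines_def by metis
    qed
    have "norm (G (w + 0 *s axis j 1)) \<le> K"
    proof (rule maximum_modulus_frontier[where S = "cball (0::complex) 2" and \<xi> = 0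
        and f = "\<lambda>\<zeta>. G (w + \<zeta> *s axis j 1)"])
      show "(\<lambda>\<zeta>. G (w + \<zeta> *s axis j 1)) holomorphic_on interior (cball 0 2)"
        using hol holomorphic_on_subset by blast
      show "continuous_on (closure (cball 0 2)) (\<lambda>\<zeta>. G (w + \<zeta> *s axis j 1))"
        using hol holomorphic_on_imp_continuous_on continuous_on_subset by blast
      fix \<zeta> :: complex assume "\<zeta> \<in> frontier (cball 0 2)"
      then have "norm (\<zeta> *s axis j 1 :: complex^'n) = 2"
        by (simp add: norm_vector_scale norm_Basis axis_in_Basis_iff Basis_complex_def)
      then have "w + \<zeta> *s axis j 1 \<in> S"
        using w(2) norm_triangle_ineq[of w "\<zeta> *s axis j 1"]
          norm_triangle_ineq2[of "\<zeta> *s axis j 1" "- w"]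
        by (auto simp: S_def add.commute)
      then show "norm (G (w + \<zeta> *s axis j 1)) \<le> K" by (rule K)
    qed auto
    then show ?thesis by simp
  qed
  then show ?thesis by blast
qed

lemma contraction_iterate: "(contraction \<mu> ^^ k) z = (\<chi> i. \<mu> i ^ k * z $ i)"
  by (induction k) (auto simp: contraction_def vec_eq_iff)

lemma contraction_iterate_mem:
  assumes "\<forall>i. \<mu> i \<noteq> 0" "z \<in> punctured_space"
  shows "(contraction \<mu> ^^ k) z \<in> punctured_space"
  by (induction k) (use assms contraction_mem_punctured_space in auto)

lemma semi_invariant_iterate:
  assumes "\<forall>i. \<mu> i \<noteq> 0" "semi_invariant \<mu> \<rho> G" "z \<in> punctured_space"
  shows "G ((contraction \<mu> ^^ k) z) = \<rho> ^ k * G z"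
proof (induction k)
  case (Suc k)
  have "G (contraction \<mu> ((contraction \<mu> ^^ k) z)) = \<rho> * G ((contraction \<mu> ^^ k) z)"
    using assms(2) contraction_iterate_mem[OF assms(1,3)] by (auto simp: semi_invariant_def)
  with Suc show ?case by simp
qed simp

lemma contraction_iterate_tendsto_0:
  assumes "hopf_multipliers \<mu>"
  shows "(\<lambda>k. (contraction \<mu> ^^ k) z) \<longlonglongrightarrow> 0"
proof (rule vec_tendstoI)
  fix i
  have "(\<lambda>k. \<mu> i ^ k * z $ i) \<longlonglongrightarrow> 0 * z $ i"
    using assms by (intro tendsto_mult_right LIMSEQ_power_zero) (simp add: hopf_multipliers_def)
  then show "(\<lambda>k. (contraction \<mu> ^^ k) z $ i) \<longlonglongrightarrow> 0 $ i"
    by (simp add: contraction_iterate)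
qed

lemma hopf_multipliers_nonzero: "hopf_multipliers \<mu> \<Longrightarrow> \<forall>i. \<mu> i \<noteq> 0"
  by (auto simp: hopf_multipliers_def)

text \<open>
  Along the orbit \<open>f^k z\<close>, which tends to the origin, the values are \<open>\<rho> ^ k * G z\<close>; they cannot stay bounded
  unless \<open>G z = 0\<close>.
\<close>

lemma expanding_semi_invariant_eq_0:
  fixes G :: "complex^'n \<Rightarrow> complex"
  assumes n: "CARD('n) \<ge> 2" and \<mu>: "hopf_multipliers \<mu>"
    and G: "holomorphic_on_lines punctured_space G" "semi_invariant \<mu> \<rho> G"
    and \<rho>: "norm \<rho> > 1" and z: "z \<in> punctured_space"
  shows "G z = 0"
proof (rule ccontr)
  assume nz: "G z \<noteq> 0"
  note \<mu>0 = hopf_multipliers_nonzero[OF \<mu>]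
  obtain K where K: "\<And>w. w \<in> punctured_space \<Longrightarrow> norm w \<le> 1 \<Longrightarrow> norm (G w) \<le> K"
    using bounded_near_puncture[OF n G(1)] by blast
  have "\<forall>\<^sub>F k in sequentially. dist ((contraction \<mu> ^^ k) z) 0 < 1"
    by (rule tendstoD[OF contraction_iterate_tendsto_0[OF \<mu>]]) simp
  then obtain k0 where k0: "\<And>k. k \<ge> k0 \<Longrightarrow> norm ((contraction \<mu> ^^ k) z) < 1"
    by (auto simp: eventually_sequentially)
  obtain N where N: "K / norm (G z) < norm \<rho> ^ N"
    using real_arch_pow[OF \<rho>] by blast
  define k where "k = max k0 N"
  have "norm (G ((contraction \<mu> ^^ k) z)) \<le> K"
    using k0[of k] by (intro K contraction_iterate_mem[OF \<mu>0 z]) (simp add: k_def)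
  then have "norm \<rho> ^ k * norm (G z) \<le> K"
    using semi_invariant_iterate[OF \<mu>0 G(2) z] by (simp add: norm_mult norm_power)
  moreover have "norm \<rho> ^ N \<le> norm \<rho> ^ k"
    using \<rho> by (intro power_increasing) (auto simp: k_def)
  ultimately have "norm \<rho> ^ N * norm (G z) \<le> K"
    by (meson mult_right_mono norm_ge_zero order_trans)
  with N nz show False by (simp add: field_simps)
qed

text \<open>
  The coordinates are changed from \<open>z $ j\<close> to \<open>\<mu> j * z $ j\<close> one after the other. A zero coordinate stays zero,
  and a nonzero one moves inside the connected set of nonzero complex numbers, on which \<open>G\<close> has derivative
  zero. So the path never meets the origin and never leaves the coordinate subspace of \<open>S\<close>, even if this
  subspace is a single axis.
\<close>

lemma invariant_if_partial_derivs_vanish: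
  fixes G :: "complex^'n \<Rightarrow> complex"
  assumes \<mu>: "\<forall>i. \<mu> i \<noteq> 0" and G: "holomorphic_on_lines punctured_space G"
    and partial: "\<And>i w. i \<in> S \<Longrightarrow> w \<in> punctured_space \<Longrightarrow> \<forall>j. j \<notin> S \<longrightarrow> w $ j = 0 \<Longrightarrow>
      dir_deriv (axis i 1) G w = 0"
    and z: "z \<in> punctured_space" "\<forall>j. j \<notin> S \<longrightarrow> z $ j = 0"
  shows "G (contraction \<mu> z) = G z"
proof -
  define p where "p T = (\<chi> i. (if i \<in> T then \<mu> i else 1) * z $ i)" for T
  have "G (p T) = G z" if "finite T" for T
    using that
  proof (induction T)
    case empty
    then show ?case by (simp add: p_def)
  next
    case (insert j T)
    show ?case
    proof (cases "z $ j = 0")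
      case True
      then have "p (insert j T) = p T" by (auto simp: p_def vec_eq_iff)
      with insert show ?thesis by simp
    next
      case False
      \<comment> \<open>\<open>w\<close> itself may be the origin; only \<open>w + \<zeta> *s axis j 1\<close> with \<open>\<zeta> \<noteq> 0\<close> is used\<close>
      define w where "w = (\<chi> i. if i = j then 0 else p T $ i)"
      have line: "w + \<zeta> *s axis j 1 \<in> punctured_space"
        "\<forall>i. i \<notin> S \<longrightarrow> (w + \<zeta> *s axis j 1) $ i = 0" if "\<zeta> \<in> - {0}" for \<zeta>
        using that z False
        by (auto simp: mem_punctured_space_iff w_def p_def axis_def intro!: exI[of _ j])
      have ends: "p T = w + z $ j *s axis j 1" "p (insert j T) = w + (\<mu> j * z $ j) *s axis j 1"
        using \<open>j \<notin> T\<close> by (auto simp: w_def p_def vec_eq_iff axis_def)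
      have "j \<in> S" using False z(2) by blast
      have "\<exists>c. \<forall>\<zeta>\<in>-{0}. G (w + \<zeta> *s axis j 1) = c"
      proof (rule DERIV_zero_connected_constant)
        show "connected (-{0::complex})" by (rule connected_punctured_universe) simp
        have deriv: "((\<lambda>\<zeta>. G (w + \<zeta> *s axis j 1)) has_field_derivative 0) (at \<zeta>)"
          if "\<zeta> \<in> - {0}" for \<zeta>
          using has_field_derivative_line[OF open_punctured_space G line(1)[OF that]]
            partial[OF \<open>j \<in> S\<close> line[OF that]] by simp
        then show "continuous_on (-{0}) (\<lambda>\<zeta>. G (w + \<zeta> *s axis j 1))"
          by (meson DERIV_continuous continuous_at_imp_continuous_on)
        show "\<forall>\<zeta>\<in>(-{0})-{}. ((\<lambda>\<zeta>. G (w + \<zeta> *s axis j 1)) has_field_derivative 0) (at \<zeta>)"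
          using deriv by blast
      qed auto
      then have "G (p (insert j T)) = G (p T)"
        unfolding ends using False \<mu> by (metis ComplI mult_eq_0_iff singletonD)
      with insert show ?thesis by simp
    qed
  qed
  from this[of UNIV] show ?thesis by (simp add: p_def contraction_def)
qed

definition monomial :: "('n::finite \<Rightarrow> complex) \<Rightarrow> ('n \<Rightarrow> nat) \<Rightarrow> complex" where
  "monomial \<mu> \<alpha> = (\<Prod>i\<in>UNIV. \<mu> i ^ \<alpha> i)"

lemma monomial_Suc: "monomial \<mu> (\<alpha>(i := Suc (\<alpha> i))) = \<mu> i * monomial \<mu> \<alpha>"
proof -
  have "monomial \<mu> (\<alpha>(i := Suc (\<alpha> i))) = \<mu> i ^ Suc (\<alpha> i) * (\<Prod>j\<in>UNIV - {i}. \<mu> j ^ \<alpha> j)"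
    unfolding monomial_def by (subst prod.remove[of _ i]) (auto intro!: prod.cong)
  also have "\<dots> = \<mu> i * monomial \<mu> \<alpha>"
    unfolding monomial_def by (subst (2) prod.remove[of _ i]) auto
  finally show ?thesis .
qed

lemma monomial_0 [simp]: "monomial \<mu> (\<lambda>_. 0) = 1"
  by (simp add: monomial_def)

text \<open>
  Formally a semi-invariant function is a combination of the monomials \<open>z^\<alpha>\<close> with \<open>\<mu>^\<alpha> = \<rho>\<close>, and on the
  coordinate subspace of \<open>S\<close> only exponents supported in \<open>S\<close> contribute. The induction is on the number \<open>N\<close> of
  derivatives after which the factor has norm above 1: if \<open>\<rho>\<close> is not a monomial, neither is \<open>\<rho> / \<mu> i\<close>, so
  the partial derivatives along the subspace vanish there. Then \<open>G (f z) = G z\<close>, while also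
  \<open>G (f z) = \<rho> * G z\<close> with \<open>\<rho> \<noteq> 1\<close>, the monomial with exponent 0.
\<close>

lemma semi_invariant_eq_0_on_coordinate_subspace:
  fixes G :: "complex^'n \<Rightarrow> complex"
  assumes n: "CARD('n) \<ge> 2" and \<mu>: "hopf_multipliers \<mu>"
    and G: "holomorphic_on_lines punctured_space G" "semi_invariant \<mu> \<rho> G"
    and \<rho>: "\<rho> \<noteq> 0" "\<And>\<alpha>. \<forall>i. i \<notin> S \<longrightarrow> \<alpha> i = 0 \<Longrightarrow> \<rho> \<noteq> monomial \<mu> \<alpha>"
    and z: "z \<in> punctured_space" "\<forall>i. i \<notin> S \<longrightarrow> z $ i = 0"
  shows "G z = 0"
proof -
  note \<mu>0 = hopf_multipliers_nonzero[OF \<mu>]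
  define M where "M = Max (range (\<lambda>i. norm (\<mu> i)))"
  have M_ge: "norm (\<mu> i) \<le> M" for i by (simp add: M_def)
  have "M \<in> range (\<lambda>i. norm (\<mu> i))" unfolding M_def by (intro Max_in) auto
  then have M: "0 < M" "M < 1" using \<mu> by (auto simp: hopf_multipliers_def)
  obtain N where "M ^ N < norm \<rho>"
    using real_arch_pow_inv[of "norm \<rho>" M] \<rho>(1) M by auto
  then show ?thesis
    using G \<rho> z
  proof (induction N arbitrary: G \<rho> z)
    case 0
    then show ?case using expanding_semi_invariant_eq_0[OF n \<mu>] by simp
  next
    case (Suc N)
    have partial: "dir_deriv (axis i 1) G w = 0"
      if "i \<in> S" "w \<in> punctured_space" "\<forall>j. j \<notin> S \<longrightarrow> w $ j = 0" for i w
    proof (rule Suc.IH)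
      show "M ^ N < norm (\<rho> / \<mu> i)"
      proof -
        have "M ^ N * norm (\<mu> i) \<le> M ^ N * M"
          using M M_ge by (intro mult_left_mono) auto
        also have "\<dots> < norm \<rho>" using Suc.prems(1) by (simp add: mult.commute)
        finally show ?thesis using \<mu>0 by (simp add: norm_divide less_divide_eq)
      qed
      show "holomorphic_on_lines punctured_space (dir_deriv (axis i 1) G)"
        by (rule holomorphic_on_lines_dir_deriv[OF open_punctured_space Suc.prems(2)])
      show "semi_invariant \<mu> (\<rho> / \<mu> i) (dir_deriv (axis i 1) G)"
        by (rule semi_invariant_dir_deriv[OF \<mu>0 Suc.prems(2,3)])
      show "\<rho> / \<mu> i \<noteq> 0" using \<mu>0 Suc.prems(4) by simp
      show "\<rho> / \<mu> i \<noteq> monomial \<mu> \<alpha>" if \<alpha>: "\<forall>j. j \<notin> S \<longrightarrow> \<alpha> j = 0" for \<alpha>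
      proof
        assume "\<rho> / \<mu> i = monomial \<mu> \<alpha>"
        then have "\<rho> = monomial \<mu> (\<alpha>(i := Suc (\<alpha> i)))"
          using \<mu>0 by (simp add: monomial_Suc field_simps)
        moreover have "\<forall>j. j \<notin> S \<longrightarrow> (\<alpha>(i := Suc (\<alpha> i))) j = 0"
          using \<alpha> \<open>i \<in> S\<close> by auto
        ultimately show False using Suc.prems(5) by blast
      qed
    qed (use that in auto)
    have "\<rho> * G z = G (contraction \<mu> z)"
      using Suc.prems(3,6) by (simp add: semi_invariant_def)
    also have "\<dots> = G z"
      by (rule invariant_if_partial_derivs_vanish[OF \<mu>0 Suc.prems(2) partial Suc.prems(6,7)])
    finally have "(\<rho> - 1) * G z = 0" by (simp add: algebra_simps)
    moreover have "\<rho> \<noteq> 1" using Suc.prems(5)[of "\<lambda>_. 0"] by simp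
    ultimately show ?case by simp
  qed
qed

section \<open>Multiplicative relations between the multipliers\<close>

definition class_degree :: "('n::finite \<Rightarrow> complex) \<Rightarrow> ('n \<Rightarrow> nat) \<Rightarrow> complex \<Rightarrow> nat" where
  "class_degree \<mu> \<alpha> v = (\<Sum>i | \<mu> i = v. \<alpha> i)"

text \<open>
  Equal multipliers are interchangeable in a monomial, so the exponents can be determined only after
  adding them up over all indices with the same multiplier. Both the generic and the
  intermediary condition on relations imply this property.
\<close>

definition independent_values :: "('n::finite \<Rightarrow> complex) \<Rightarrow> bool" where
  "independent_values \<mu> \<longleftrightarrow>
    (\<forall>\<alpha> \<beta>. monomial \<mu> \<alpha> = monomial \<mu> \<beta> \<longrightarrow> class_degree \<mu> \<alpha> = class_degree \<mu> \<beta>)"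

text \<open>
  \<open>B\<close> consists of the indices of one value of \<open>\<mu>\<close>, the only one that may be repeated, or is empty, as for
  generic manifolds. That \<open>B\<close> is proper excludes the case of equal multipliers, in which nonintegrable
  forms such as \<open>z_1 dz_2 - z_2 dz_1 + z_3 dz_4 - z_4 dz_3\<close> occur.
\<close>

definition single_block :: "('n::finite \<Rightarrow> complex) \<Rightarrow> 'n set \<Rightarrow> bool" where
  "single_block \<mu> B \<longleftrightarrow>
    B \<noteq> UNIV \<and> inj_on \<mu> (- B) \<and> (\<forall>i\<in>B. \<forall>j. \<mu> j = \<mu> i \<longleftrightarrow> j \<in> B)"

text \<open>
  Cancelling the common part \<open>min (\<alpha> i) (\<beta> i)\<close> of the exponents turns an equality of two monomials
  into a relation with disjoint supports.
\<close>

lemma no_relation_imp_exponents_eq: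
  fixes \<mu> :: "'n::finite \<Rightarrow> complex"
  assumes S: "no_relation S \<mu>" and \<mu>: "\<forall>i. \<mu> i \<noteq> 0"
    and eq: "(\<Prod>i\<in>S. \<mu> i ^ \<alpha> i) = (\<Prod>i\<in>S. \<mu> i ^ \<beta> i)" and i: "i \<in> S"
  shows "\<alpha> i = \<beta> i"
proof -
  define A where "A = {i \<in> S. \<beta> i \<le> \<alpha> i}"
  define B where "B = S - A"
  define r where "r = (\<lambda>i. if \<beta> i \<le> \<alpha> i then \<alpha> i - \<beta> i else \<beta> i - \<alpha> i)"
  define m where "m = (\<Prod>i\<in>S. \<mu> i ^ min (\<alpha> i) (\<beta> i))"
  have split: "(\<Prod>i\<in>S. \<mu> i ^ \<gamma> i) = m * (\<Prod>i\<in>C. \<mu> i ^ r i)"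
    if C: "C \<subseteq> S" "\<And>i. i \<in> S \<Longrightarrow> \<gamma> i = min (\<alpha> i) (\<beta> i) + (if i \<in> C then r i else 0)" for \<gamma> C
  proof -
    have "(\<Prod>i\<in>S. \<mu> i ^ \<gamma> i)
        = (\<Prod>i\<in>S. \<mu> i ^ min (\<alpha> i) (\<beta> i) * (if i \<in> C then \<mu> i ^ r i else 1))"
      using C by (intro prod.cong) (auto simp: power_add)
    also have "\<dots> = m * (\<Prod>i\<in>S \<inter> C. \<mu> i ^ r i)"
      by (simp add: prod.distrib m_def prod.inter_restrict)
    finally show ?thesis using C(1) by (simp add: Int_absorb1)
  qed
  have "m * (\<Prod>i\<in>A. \<mu> i ^ r i) = (\<Prod>i\<in>S. \<mu> i ^ \<alpha> i)"
    by (rule split[symmetric]) (auto simp: A_def r_def)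
  also have "\<dots> = m * (\<Prod>i\<in>B. \<mu> i ^ r i)"
    unfolding eq by (rule split) (auto simp: A_def B_def r_def)
  finally have "(\<Prod>i\<in>A. \<mu> i ^ r i) = (\<Prod>i\<in>B. \<mu> i ^ r i)"
    using \<mu> by (auto simp: m_def)
  moreover have "A \<inter> B = {}" "A \<union> B = S" by (auto simp: A_def B_def)
  ultimately have "r i = 0" using S i unfolding no_relation_def by blast
  then show ?thesis by (auto simp: r_def split: if_splits)
qed

lemma no_relation_imp_inj_on:
  fixes \<mu> :: "'n::finite \<Rightarrow> complex"
  assumes S: "no_relation S \<mu>" and \<mu>: "\<forall>i. \<mu> i \<noteq> 0"
  shows "inj_on \<mu> S"
proof (rule inj_onI, rule ccontr)
  fix i j assume ij: "i \<in> S" "j \<in> S" "\<mu> i = \<mu> j" "i \<noteq> j"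
  have delta: "(\<Prod>l\<in>S. \<mu> l ^ (if l = k then 1 else 0)) = \<mu> k" if "k \<in> S" for k
    using that by (simp add: if_distrib[of "\<lambda>x. _ ^ x"] prod.delta cong: if_cong)
  have "(if i = i then 1 else 0) = (if i = j then 1 else (0::nat))"
    by (rule no_relation_imp_exponents_eq[OF S \<mu> _ ij(1)]) (simp only: delta ij)
  with ij(4) show False by simp
qed

lemma monomial_eq_prod_values:
  fixes \<mu> :: "'n::finite \<Rightarrow> complex"
  assumes inj: "inj_on \<mu> S" and range: "\<mu> ` S = range \<mu>"
  shows "monomial \<mu> \<alpha> = (\<Prod>s\<in>S. \<mu> s ^ class_degree \<mu> \<alpha> (\<mu> s))"
proof -
  have "monomial \<mu> \<alpha> = (\<Prod>v\<in>range \<mu>. \<Prod>i | \<mu> i = v. \<mu> i ^ \<alpha> i)"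
    unfolding monomial_def using prod.image_gen[of UNIV "\<lambda>i. \<mu> i ^ \<alpha> i" \<mu>] by simp
  also have "\<dots> = (\<Prod>v\<in>range \<mu>. v ^ class_degree \<mu> \<alpha> v)"
    by (intro prod.cong) (auto simp: class_degree_def power_sum)
  also have "\<dots> = (\<Prod>s\<in>S. \<mu> s ^ class_degree \<mu> \<alpha> (\<mu> s))"
    unfolding range[symmetric] by (simp add: prod.reindex[OF inj])
  finally show ?thesis .
qed

lemma no_relation_imp_independent_values:
  fixes \<mu> :: "'n::finite \<Rightarrow> complex"
  assumes S: "no_relation S \<mu>" and \<mu>: "\<forall>i. \<mu> i \<noteq> 0" and range: "\<mu> ` S = range \<mu>"
  shows "independent_values \<mu>"
  unfolding independent_values_def
proof (intro allI impI ext)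
  fix \<alpha> \<beta> v assume eq: "monomial \<mu> \<alpha> = monomial \<mu> \<beta>"
  show "class_degree \<mu> \<alpha> v = class_degree \<mu> \<beta> v"
  proof (cases "v \<in> range \<mu>")
    case True
    then obtain s where s: "s \<in> S" "v = \<mu> s" using range by auto
    note by_values = monomial_eq_prod_values[OF no_relation_imp_inj_on[OF S \<mu>] range]
    show ?thesis
      using no_relation_imp_exponents_eq[OF S \<mu> _ s(1), where \<alpha> = "\<lambda>s. class_degree \<mu> \<alpha> (\<mu> s)"
          and \<beta> = "\<lambda>s. class_degree \<mu> \<beta> (\<mu> s)"] eq unfolding by_values s(2) by blast
  next
    case False
    then have "{i. \<mu> i = v} = {}" by auto
    then show ?thesis by (simp only: class_degree_def sum.empty)
  qed
qed

lemma generic_imp_single_block: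
  fixes \<mu> :: "'n::{finite,linorder} \<Rightarrow> complex"
  assumes "generic \<mu>" "\<forall>i. \<mu> i \<noteq> 0"
  shows "independent_values \<mu> \<and> single_block \<mu> {}"
proof -
  have rel: "no_relation UNIV \<mu>" using assms(1) unfolding generic_def by blast
  show ?thesis
    using no_relation_imp_independent_values[OF rel assms(2)] no_relation_imp_inj_on[OF rel assms(2)]
    by (simp add: single_block_def)
qed

lemma pos_less: "i < j \<Longrightarrow> pos i < pos (j :: 'n::{finite,linorder})"
  unfolding pos_def by (rule psubset_card_mono, simp, rule psubsetI)
    (auto dest: order.strict_trans1 order.strict_implies_order simp: set_eq_iff not_le)

lemma inj_pos: "inj (pos :: 'n::{finite,linorder} \<Rightarrow> nat)"
  by (rule linorder_injI) (metis pos_less less_irrefl)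

lemma pos_pos: "pos (i :: 'n::{finite,linorder}) \<ge> 1"
  unfolding pos_def using card_gt_0_iff[of "{j. j \<le> i}"] by (auto simp: Suc_le_eq)

lemma pos_Min: "pos (Min UNIV :: 'n::{finite,linorder}) = 1"
proof -
  have "{j. j \<le> (Min UNIV :: 'n)} = {Min UNIV}" by (auto intro: antisym)
  then show ?thesis by (simp add: pos_def)
qed

text \<open>
  The first index represents the block \<open>B\<close>, so the index set \<open>S\<close> of the relation hypothesis contains exactly
  one index for each value of \<open>\<mu>\<close>.
\<close>

lemma intermediary_imp_single_block:
  fixes \<mu> :: "'n::{finite,linorder} \<Rightarrow> complex"
  assumes "intermediary \<mu>" and \<mu>: "\<forall>i. \<mu> i \<noteq> 0"
  shows "\<exists>B. independent_values \<mu> \<and> single_block \<mu> B"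
proof -
  obtain r where r: "2 \<le> r" "r \<le> CARD('n) - 1"
    and block: "\<And>i j. pos i \<le> r \<Longrightarrow> pos j \<le> r \<Longrightarrow> \<mu> i = \<mu> j"
    and rel: "no_relation {i. pos i = 1 \<or> r < pos i} \<mu>"
    using assms(1) unfolding intermediary_def by blast
  define S where "S = {i :: 'n. pos i = 1 \<or> r < pos i}"
  define B where "B = {i :: 'n. pos i \<le> r}"
  have inj: "inj_on \<mu> S" using no_relation_imp_inj_on[OF rel \<mu>] by (simp add: S_def)
  have first: "Min UNIV \<in> S" "Min UNIV \<in> B" using r by (auto simp: S_def B_def pos_Min)
  have "card B \<le> card {1..r}"
    by (rule card_inj_on_le[OF inj_on_subset[OF inj_pos]]) (use pos_pos in \<open>auto simp: B_def\<close>)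
  moreover have "CARD('n) > 0" by simp
  ultimately have "B \<noteq> UNIV" using r by auto
  moreover have "inj_on \<mu> (- B)"
    by (rule inj_on_subset[OF inj]) (auto simp: B_def S_def)
  moreover have "j \<in> B" if "i \<in> B" "\<mu> j = \<mu> i" for i j
  proof (rule ccontr)
    assume "j \<notin> B"
    then have "j \<in> S" by (auto simp: B_def S_def)
    moreover have "\<mu> j = \<mu> (Min UNIV)"
      using that first(2) block[of i "Min UNIV"] by (simp add: B_def)
    ultimately have "j = Min UNIV" using inj first(1) by (auto dest: inj_onD)
    with first(2) \<open>j \<notin> B\<close> show False by simp
  qed
  moreover have "\<mu> j = \<mu> i" if "i \<in> B" "j \<in> B" for i j
    using that block[of j i] by (simp add: B_def)
  ultimately have "single_block \<mu> B"
    unfolding single_block_def by blast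
  moreover have "\<mu> i \<in> \<mu> ` S" for i
  proof (cases "i \<in> S")
    case False
    then have "\<mu> i = \<mu> (Min UNIV)" using first(2) block[of i "Min UNIV"] by (simp add: S_def B_def)
    then show ?thesis using first(1) by blast
  qed blast
  then have "\<mu> ` S = range \<mu>" by auto
  then have "independent_values \<mu>"
    using no_relation_imp_independent_values[OF rel \<mu>] by (simp add: S_def)
  ultimately show ?thesis by blast
qed

lemma sum_fun_upd_Suc:
  fixes \<alpha> :: "'n::finite \<Rightarrow> nat"
  assumes "i \<in> A"
  shows "sum (\<alpha>(i := Suc (\<alpha> i))) A = Suc (sum \<alpha> A)"
proof -
  have "sum (\<alpha>(i := Suc (\<alpha> i))) A = (\<Sum>j\<in>A. \<alpha> j + (if j = i then 1 else 0))"
    by (intro sum.cong) auto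
  then show ?thesis using assms by (simp add: sum.distrib)
qed

lemma independent_values_total_degree:
  assumes "independent_values \<mu>" "monomial \<mu> \<alpha> = monomial \<mu> \<beta>"
  shows "sum \<alpha> UNIV = sum \<beta> UNIV"
proof -
  have by_class: "sum \<gamma> UNIV = (\<Sum>v\<in>range \<mu>. class_degree \<mu> \<gamma> v)" for \<gamma>
    unfolding class_degree_def by (subst sum.image_gen[of UNIV \<gamma> \<mu>]) simp_all
  have "class_degree \<mu> \<alpha> = class_degree \<mu> \<beta>"
    using assms unfolding independent_values_def by blast
  then show ?thesis by (simp only: by_class)
qed

lemma independent_values_power_times:
  fixes \<mu> :: "'n::finite \<Rightarrow> complex"
  assumes ind: "independent_values \<mu>" and eq: "\<mu> j ^ k * \<mu> i = \<mu> j' ^ k' * \<mu> i'"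
  shows "(if \<mu> j = v then k else 0) + (if \<mu> i = v then 1 else 0) =
    (if \<mu> j' = v then k' else 0) + (if \<mu> i' = v then 1 else (0::nat))"
proof -
  define \<delta> where "\<delta> = (\<lambda>(j::'n) k i l. (if l = j then k else 0) + (if l = i then 1 else (0::nat)))"
  have "monomial \<mu> (\<delta> j k i) = \<mu> j ^ k * \<mu> i" for j k i
    by (simp add: monomial_def \<delta>_def power_add prod.distrib if_distrib[of "\<lambda>x. _ ^ x"] prod.delta
      cong: if_cong)
  moreover have "class_degree \<mu> (\<delta> j k i) v
      = (if \<mu> j = v then k else 0) + (if \<mu> i = v then 1 else 0)" for j k i
    by (simp add: class_degree_def \<delta>_def sum.distrib sum.delta)
  ultimately show ?thesis
    using ind eq unfolding independent_values_def by metis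
qed

text \<open>
  For each value \<open>v\<close> of \<open>\<mu>\<close>, let the degree of \<open>c\<close> at \<open>v\<close> be the number of factors \<open>v\<close> in
  \<open>c = \<mu> j ^ k * \<mu> i\<close>; by independence it does not depend on \<open>j\<close>. If \<open>c\<close> is not itself a multiplier, then
  \<open>k \<ge> 1\<close> and so the degree at \<open>\<mu> j\<close> is positive, for every \<open>j\<close>. On the other hand, the presentation for one
  \<open>j\<close> has only the single factor \<open>\<mu> i\<close> available for all values other than \<open>\<mu> j\<close>. Hence there are at most
  two values, and if there are two, each has degree exactly 1. In dimension at least 3 there are then
  exactly two values, and the one outside the block belongs to a single index \<open>s\<close>.
\<close>

lemma conormal_multiplier_cases:
  fixes \<mu> :: "'n::finite \<Rightarrow> complex"
  assumes n: "CARD('n) \<ge> 3" and ind: "independent_values \<mu>" and B: "single_block \<mu> B"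
    and c: "\<And>j. \<exists>k i. c = \<mu> j ^ k * \<mu> i"
  obtains p where "c = \<mu> p"
  | i j s where "i \<noteq> j" "i \<noteq> s" "j \<noteq> s" "\<And>l. l \<noteq> s \<Longrightarrow> \<mu> l = \<mu> i" "\<mu> s \<noteq> \<mu> i" "c = \<mu> i * \<mu> s"
proof (cases "\<exists>p. c = \<mu> p")
  case True
  then show ?thesis using that(1) by blast
next
  case False
  obtain K I where KI: "\<And>j. c = \<mu> j ^ K j * \<mu> (I j)" using c by metis
  have K: "K j \<ge> 1" for j using KI[of j] False by (cases "K j") auto
  have deg: "(if \<mu> j = v then K j else 0) + (if \<mu> (I j) = v then 1 else 0) =
    (if \<mu> l = v then K l else 0) + (if \<mu> (I l) = v then 1 else (0::nat))" for j l v
    by (rule independent_values_power_times[OF ind]) (metis KI)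
  have other: "\<mu> (I j) = \<mu> l" if "\<mu> j \<noteq> \<mu> l" for j l
    using deg[of j "\<mu> l" l] that K[of l] by (auto split: if_splits)
  have no_three: "\<mu> j = \<mu> l \<or> \<mu> l = \<mu> m \<or> \<mu> j = \<mu> m" for j l m
    using other[of j l] other[of j m] by metis
  have inj: "inj_on \<mu> (- B)" and eqB: "\<And>i j. i \<in> B \<Longrightarrow> \<mu> j = \<mu> i \<longleftrightarrow> j \<in> B"
    using B unfolding single_block_def by blast+
  obtain s where s: "s \<notin> B" using B unfolding single_block_def by blast
  obtain T :: "'n set" where T: "card T = 3" by (rule obtain_subset_with_card_n[OF n])
  then obtain x y z :: 'n where xyz: "x \<noteq> y" "y \<noteq> z" "x \<noteq> z" unfolding card_3_iff by blast
  have "B \<noteq> {}"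
  proof
    assume "B = {}"
    with inj have "inj \<mu>" by simp
    then show False using no_three[of x y z] xyz by (metis injD)
  qed
  then obtain b where b: "b \<in> B" by blast
  have "t = s" if "t \<notin> B" for t
    using no_three[of b s t] eqB[OF b] s that inj by (metis ComplI inj_onD)
  then have B_eq: "B = - {s}" using s by blast
  obtain i j where ij: "i \<noteq> j" "i \<noteq> s" "j \<noteq> s" using xyz by metis
  have "\<mu> s \<noteq> \<mu> i" using eqB[of i s] ij B_eq by blast
  moreover have "c = \<mu> i * \<mu> s"
  proof -
    have "\<mu> (I i) = \<mu> s" "\<mu> (I s) = \<mu> i" using other \<open>\<mu> s \<noteq> \<mu> i\<close> by metis+
    then have "K i = 1" using deg[of i "\<mu> i" s] \<open>\<mu> s \<noteq> \<mu> i\<close> by auto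
    then show ?thesis using KI[of i] \<open>\<mu> (I i) = \<mu> s\<close> by simp
  qed
  moreover have "\<mu> l = \<mu> i" if "l \<noteq> s" for l using eqB[of i l] ij B_eq that by blast
  ultimately show ?thesis using that(2) ij by blast
qed

section \<open>Semi-invariant one-forms\<close>

text \<open>
  Such a function is linear in \<open>z_i, z_j\<close> on the plane spanned by the two axes, and a linear form in two
  variables has a nontrivial zero. On the affine line \<open>e_i + y e_j\<close> the function has the form \<open>a + h * y\<close>,
  since the second derivative of \<open>G\<close> in \<open>z_j\<close> has the factor \<open>1 / \<rho>\<close> and therefore vanishes. If \<open>h \<noteq> 0\<close>, there is a zero on this
  line. If \<open>h = 0\<close>, semi-invariance gives the value \<open>\<rho> ^ k * a\<close> at \<open>\<rho> ^ k e_i + e_j\<close>, so \<open>G\<close> vanishes at \<open>e_j\<close> by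
  continuity.
\<close>

lemma semi_invariant_linear_zero:
  fixes G :: "complex^'n \<Rightarrow> complex"
  assumes n: "CARD('n) \<ge> 2" and \<mu>: "hopf_multipliers \<mu>"
    and G: "holomorphic_on_lines punctured_space G" "semi_invariant \<mu> \<rho> G"
    and ij: "i \<noteq> j" "\<mu> i = \<rho>" "\<mu> j = \<rho>"
  shows "\<exists>z\<in>punctured_space. (\<forall>l. l \<noteq> i \<and> l \<noteq> j \<longrightarrow> z $ l = 0) \<and> G z = 0"
proof (rule ccontr)
  assume no_zero: "\<not> ?thesis"
  note \<mu>0 = hopf_multipliers_nonzero[OF \<mu>]
  have \<rho>: "\<rho> \<noteq> 0" "norm \<rho> < 1" using \<mu>0 ij \<mu> by (auto simp: hopf_multipliers_def)
  define H where "H = dir_deriv (axis j 1) G"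
  have H: "holomorphic_on_lines punctured_space H" "semi_invariant \<mu> 1 H"
    unfolding H_def
    using holomorphic_on_lines_dir_deriv[OF open_punctured_space G(1)]
      semi_invariant_dir_deriv[OF \<mu>0 G, of j] ij \<rho> by auto
  define p :: "complex \<Rightarrow> complex \<Rightarrow> complex^'n"
    where "p = (\<lambda>x y. \<chi> l. if l = i then x else if l = j then y else 0)"
  have p: "p x y \<in> punctured_space" if "x \<noteq> 0 \<or> y \<noteq> 0" for x y
    using that ij by (auto simp: p_def mem_punctured_space_iff)
  have p_line: "p x y = p x 0 + y *s axis j 1" for x y
    using ij by (auto simp: p_def vec_eq_iff axis_def)
  have nz: "G (p x y) \<noteq> 0" if "x \<noteq> 0 \<or> y \<noteq> 0" for x y
    using no_zero p[OF that] by (auto simp: p_def)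
  have H_const: "H (p 1 y) = H (p 1 0)" for y
  proof -
    have "\<exists>c. \<forall>y\<in>UNIV. H (p 1 y) = c"
    proof (rule has_field_derivative_zero_constant)
      fix y
      have "dir_deriv (axis j 1) H (p 1 y) = 0"
      proof (rule expanding_semi_invariant_eq_0[OF n \<mu>])
        show "holomorphic_on_lines punctured_space (dir_deriv (axis j 1) H)"
          by (rule holomorphic_on_lines_dir_deriv[OF open_punctured_space H(1)])
        show "semi_invariant \<mu> (1 / \<rho>) (dir_deriv (axis j 1) H)"
          using semi_invariant_dir_deriv[OF \<mu>0 H, of j] ij by simp
        show "norm (1 / \<rho>) > 1" using \<rho> by (simp add: norm_divide)
      qed (rule p, simp)
      then show "((\<lambda>y. H (p 1 y)) has_field_derivative 0) (at y within UNIV)"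
        using has_field_derivative_line[OF open_punctured_space H(1), of "p 1 0" y "axis j 1"]
          p[of 1 y] by (simp flip: p_line)
    qed simp
    then show ?thesis by (metis UNIV_I)
  qed
  define h where "h = H (p 1 0)"
  have "\<exists>c. \<forall>y\<in>UNIV. G (p 1 y) - h * y = c"
  proof (rule has_field_derivative_zero_constant)
    fix y
    have "((\<lambda>y. G (p 1 y)) has_field_derivative h) (at y)"
      using has_field_derivative_line[OF open_punctured_space G(1), of "p 1 0" y "axis j 1"]
        p[of 1 y] H_const[of y] by (simp add: h_def H_def flip: p_line)
    then show "((\<lambda>y. G (p 1 y) - h * y) has_field_derivative 0) (at y within UNIV)"
      by (auto intro!: derivative_eq_intros)
  qed simp
  then have affine: "G (p 1 y) = G (p 1 0) + h * y" for y
    by (metis UNIV_I add_diff_cancel_right' diff_add_cancel diff_zero mult_zero_right)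
  have "h = 0"
  proof (rule ccontr)
    assume "h \<noteq> 0"
    then have "G (p 1 (- G (p 1 0) / h)) = 0" by (subst affine) simp
    with nz show False by simp
  qed
  have orbit: "G (p (\<rho> ^ k) 1) = \<rho> ^ k * G (p 1 0)" for k
  proof -
    \<comment> \<open>the \<open>k\<close>-th iterate multiplies both coordinates by \<open>\<rho> ^ k\<close>, so it starts on the affine line\<close>
    have "p (\<rho> ^ k) 1 = (contraction \<mu> ^^ k) (p 1 (1 / \<rho> ^ k))"
      using ij \<rho> by (auto simp: contraction_iterate p_def vec_eq_iff)
    then have "G (p (\<rho> ^ k) 1) = \<rho> ^ k * G (p 1 (1 / \<rho> ^ k))"
      using semi_invariant_iterate[OF \<mu>0 G(2)] p by simp
    with affine \<open>h = 0\<close> show ?thesis by simp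
  qed
  have "(\<lambda>k. G (p (\<rho> ^ k) 1)) \<longlonglongrightarrow> 0 * G (p 1 0)"
    unfolding orbit using \<rho> by (intro tendsto_mult_right LIMSEQ_power_zero)
  moreover have "(\<lambda>k. G (p (\<rho> ^ k) 1)) \<longlonglongrightarrow> G (p 0 1)"
  proof (rule continuous_on_tendsto_compose[where s = punctured_space])
    show "continuous_on punctured_space G" using G by (simp add: holomorphic_on_lines_def)
    show "(\<lambda>k. p (\<rho> ^ k) 1) \<longlonglongrightarrow> p 0 1"
    proof (rule vec_tendstoI)
      show "(\<lambda>k. p (\<rho> ^ k) 1 $ l) \<longlonglongrightarrow> p 0 1 $ l" for l
        using \<rho> by (auto simp: p_def intro: LIMSEQ_power_zero)
    qed
  qed (use p in auto)
  ultimately have "G (p 0 1) = 0" using LIMSEQ_unique by fastforce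
  with nz show False by simp
qed

text \<open>
  On the axis of \<open>z_j\<close> some coefficient is nonzero, hence its factor is a power of \<open>\<mu> j\<close>; this puts \<open>c\<close> into
  one of two forms. If \<open>c = \<mu> p\<close>, the factor \<open>\<mu> p / (\<mu> i * \<mu> j)\<close> of a derivative cannot be a monomial, by
  comparing total degrees 1 and at least 2. If \<open>c = \<mu> i' * \<mu> s\<close>, the form would have a zero on the hyperplane
  \<open>z_s = 0\<close>: there the coefficients other than \<open>g s\<close> vanish identically, because their factor \<open>\<mu> s\<close> is not a
  power of the multiplier of the block, and \<open>g s\<close> has a zero because its factor is that multiplier.
\<close>

lemma semi_invariant_coefficients_locally_constant:
  fixes g :: "'n::finite \<Rightarrow> complex^'n \<Rightarrow> complex"
  assumes n: "CARD('n) \<ge> 3" and \<mu>: "hopf_multipliers \<mu>"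
    and ind: "independent_values \<mu>" and B: "single_block \<mu> B" and c: "c \<noteq> 0"
    and hol: "\<And>i. holomorphic_on_lines punctured_space (g i)"
    and inv: "\<And>i. semi_invariant \<mu> (c / \<mu> i) (g i)"
    and nz: "\<And>z. z \<in> punctured_space \<Longrightarrow> \<exists>i. g i z \<noteq> 0"
    and z: "z \<in> punctured_space"
  shows "dir_deriv (axis j 1) (g i) z = 0"
proof -
  note \<mu>0 = hopf_multipliers_nonzero[OF \<mu>]
  have n2: "CARD('n) \<ge> 2" using n by simp
  have c_form: "\<exists>k i. c = \<mu> j ^ k * \<mu> i" for j
  proof -
    have ax: "axis j 1 \<in> (punctured_space :: (complex^'n) set)"
      by (auto simp: mem_punctured_space_iff axis_def)
    obtain i where i: "g i (axis j 1) \<noteq> 0" using nz[OF ax] by blast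
    have "\<exists>\<alpha>. (\<forall>l. l \<notin> {j} \<longrightarrow> \<alpha> l = 0) \<and> c / \<mu> i = monomial \<mu> \<alpha>"
    proof (rule ccontr)
      assume no: "\<not> ?thesis"
      have "g i (axis j 1) = 0"
      proof (rule semi_invariant_eq_0_on_coordinate_subspace[OF n2 \<mu> hol inv, where S = "{j}"])
        show "c / \<mu> i \<noteq> monomial \<mu> \<alpha>" if "\<forall>l. l \<notin> {j} \<longrightarrow> \<alpha> l = 0" for \<alpha>
          using no that by blast
      qed (use c \<mu>0 ax in \<open>auto simp: axis_def\<close>)
      with i show False by simp
    qed
    then obtain \<alpha> where \<alpha>: "\<forall>l. l \<notin> {j} \<longrightarrow> \<alpha> l = 0" "c / \<mu> i = monomial \<mu> \<alpha>" by blast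
    have "monomial \<mu> \<alpha> = \<mu> j ^ \<alpha> j"
      unfolding monomial_def using \<alpha>(1) by (subst prod.remove[of _ j]) auto
    then have "c = \<mu> j ^ \<alpha> j * \<mu> i" using \<alpha>(2) \<mu>0 by (simp add: field_simps)
    then show ?thesis by blast
  qed
  show ?thesis
  proof (rule conormal_multiplier_cases[OF n ind B c_form])
    fix p assume p: "c = \<mu> p"
    show ?thesis
    proof (rule semi_invariant_eq_0_on_coordinate_subspace[OF n2 \<mu>, where S = UNIV])
      show "holomorphic_on_lines punctured_space (dir_deriv (axis j 1) (g i))"
        by (rule holomorphic_on_lines_dir_deriv[OF open_punctured_space hol])
      show "semi_invariant \<mu> (c / \<mu> i / \<mu> j) (dir_deriv (axis j 1) (g i))"
        by (rule semi_invariant_dir_deriv[OF \<mu>0 hol inv])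
      show "c / \<mu> i / \<mu> j \<noteq> 0" using c \<mu>0 by simp
      show "c / \<mu> i / \<mu> j \<noteq> monomial \<mu> \<alpha>" for \<alpha>
      proof
        assume eq: "c / \<mu> i / \<mu> j = monomial \<mu> \<alpha>"
        define \<alpha>' where "\<alpha>' = \<alpha>(i := Suc (\<alpha> i))"
        define \<beta> where "\<beta> = \<alpha>'(j := Suc (\<alpha>' j))"
        define \<epsilon> :: "'n \<Rightarrow> nat" where "\<epsilon> = (\<lambda>_. 0)(p := Suc 0)"
        have "monomial \<mu> \<beta> = \<mu> j * (\<mu> i * monomial \<mu> \<alpha>)"
          unfolding \<beta>_def \<alpha>'_def monomial_Suc by simp
        also have "\<dots> = \<mu> p" using eq p \<mu>0 by (simp add: field_simps flip: eq)
        also have "\<dots> = monomial \<mu> \<epsilon>"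
          using monomial_Suc[of \<mu> "\<lambda>_. 0" p] by (simp add: \<epsilon>_def)
        finally have "sum \<beta> UNIV = sum \<epsilon> UNIV"
          by (rule independent_values_total_degree[OF ind])
        then show False
          by (simp add: \<beta>_def \<alpha>'_def \<epsilon>_def sum_fun_upd_Suc
              sum_fun_upd_Suc[of p UNIV "\<lambda>_. 0"] del: fun_upd_apply)
      qed
    qed (use z in auto)
  next
    fix i' j' s
    assume ij: "i' \<noteq> j'" "i' \<noteq> s" "j' \<noteq> s" and eq: "\<And>l. l \<noteq> s \<Longrightarrow> \<mu> l = \<mu> i'"
      and ne: "\<mu> s \<noteq> \<mu> i'" and c_eq: "c = \<mu> i' * \<mu> s"
    have "semi_invariant \<mu> (\<mu> i') (g s)" using inv[of s] c_eq \<mu>0 by simp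
    from semi_invariant_linear_zero[OF n2 \<mu> hol this ij(1)] eq ij
    obtain w where w: "w \<in> punctured_space" "\<And>l. l \<noteq> i' \<and> l \<noteq> j' \<Longrightarrow> w $ l = 0" "g s w = 0"
      by metis
    have "g l w = 0" for l
    proof (cases "l = s")
      case False
      then have factor: "c / \<mu> l = \<mu> s" using eq c_eq \<mu>0 by simp
      show ?thesis
      proof (rule semi_invariant_eq_0_on_coordinate_subspace[OF n2 \<mu> hol inv, where S = "- {s}"])
        show "c / \<mu> l \<noteq> monomial \<mu> \<alpha>" if \<alpha>: "\<forall>i. i \<notin> - {s} \<longrightarrow> \<alpha> i = 0" for \<alpha>
        proof
          assume "c / \<mu> l = monomial \<mu> \<alpha>"
          then have "monomial \<mu> ((\<lambda>_. 0)(s := Suc 0)) = monomial \<mu> \<alpha>"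
            using factor monomial_Suc[of \<mu> "\<lambda>_. 0" s] by simp
          then have "class_degree \<mu> ((\<lambda>_. 0)(s := Suc 0)) = class_degree \<mu> \<alpha>"
            using ind unfolding independent_values_def by blast
          then have "class_degree \<mu> ((\<lambda>_. 0)(s := Suc 0)) (\<mu> s) = class_degree \<mu> \<alpha> (\<mu> s)"
            by (rule fun_cong)
          moreover have "\<mu> l = \<mu> s \<longleftrightarrow> l = s" for l
            using eq[of l] ne by (cases "l = s") auto
          then have "{l. \<mu> l = \<mu> s} = {s}" by simp
          ultimately show False using \<alpha> by (simp add: class_degree_def)
        qed
      qed (use w ij c \<mu>0 in auto)
    qed (use w in simp)
    with nz[OF w(1)] show ?thesis by blast
  qed
qed

section \<open>The pulled back form of a distribution\<close>

lemma bij_betw_contraction: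
  assumes "\<forall>i. \<mu> i \<noteq> 0"
  shows "bij_betw (contraction \<mu>) punctured_space punctured_space"
proof (rule bij_betw_byWitness[where f' = "contraction (\<lambda>i. 1 / \<mu> i)"])
  show "contraction \<mu> ` punctured_space \<subseteq> punctured_space"
    "contraction (\<lambda>i. 1 / \<mu> i) ` punctured_space \<subseteq> punctured_space"
    using contraction_mem_punctured_space[of \<mu>] contraction_mem_punctured_space[of "\<lambda>i. 1 / \<mu> i"]
      assms by auto
qed (use assms in \<open>auto simp: contraction_def vec_eq_iff\<close>)

lemma bij_betw_cotangent_action:
  assumes "\<forall>i. \<mu> i \<noteq> 0"
  shows "bij_betw (cotangent_action \<mu>) (punctured_space \<times> UNIV) (punctured_space \<times> UNIV)"
proof -
  have "bij_betw (\<lambda>\<xi>. \<chi> i. \<xi> $ i / \<mu> i) UNIV (UNIV :: (complex^'a) set)"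
    by (rule bij_betw_byWitness[where f' = "\<lambda>\<xi>. \<chi> i. \<xi> $ i * \<mu> i"])
      (use assms in \<open>auto simp: vec_eq_iff\<close>)
  from bij_betw_map_prod[OF bij_betw_contraction[OF assms] this]
  show ?thesis by (simp add: cotangent_action_def map_prod_def)
qed

lemma bij_betw_line_action:
  assumes "\<forall>i. \<mu> i \<noteq> 0" "b \<noteq> 0"
  shows "bij_betw (line_action \<mu> b) (punctured_space \<times> UNIV) (punctured_space \<times> UNIV)"
proof -
  have "bij_betw ((*) b) UNIV UNIV"
    by (rule bij_betw_byWitness[where f' = "\<lambda>v. v / b"]) (use assms in auto)
  from bij_betw_map_prod[OF bij_betw_contraction[OF assms(1)] this]
  show ?thesis by (simp add: line_action_def map_prod_def)
qed

lemma orbit_rel_class_step: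
  assumes F: "bij_betw F A A" and x: "x \<in> A"
  shows "orbit_rel A F `` {x} = orbit_rel A F `` {F x}"
proof (rule equiv_class_eq[OF orbit_rel_equiv[OF F]])
  have "F x \<in> A" using F x by (auto simp: bij_betw_def)
  moreover have "(F ^^ 1) x = F x" by simp
  ultimately show "(x, F x) \<in> orbit_rel A F" unfolding orbit_rel_def using x by blast
qed

lemma cotangent_action_iterate:
  "(cotangent_action \<mu> ^^ k) (z, \<xi>) = (\<chi> i. \<mu> i ^ k * z $ i, \<chi> i. \<xi> $ i / \<mu> i ^ k)"
  by (induction k) (auto simp: cotangent_action_def contraction_def vec_eq_iff)

text \<open>
  Representatives of one orbit differ by an integer power of the action. The exponents have opposite
  signs on points and on covectors, hence the asymmetric form of the two equations.
\<close>

lemma cotangent_class_eqD: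
  assumes \<mu>: "\<forall>i. \<mu> i \<noteq> 0" and z: "z \<in> punctured_space" and w: "w \<in> punctured_space"
    and eq: "cotangent_rel \<mu> `` {(z, \<xi>)} = cotangent_rel \<mu> `` {(w, \<eta>)}"
  shows "\<exists>k::int. \<forall>i. w $ i = \<mu> i powi k * z $ i \<and> \<xi> $ i = \<mu> i powi k * \<eta> $ i"
proof -
  have "((z, \<xi>), (w, \<eta>)) \<in> cotangent_rel \<mu>"
    using eq_equiv_class[OF eq[unfolded cotangent_rel_def]
      orbit_rel_equiv[OF bij_betw_cotangent_action[OF \<mu>]]] w by (simp add: cotangent_rel_def)
  then obtain k where "(cotangent_action \<mu> ^^ k) (z, \<xi>) = (w, \<eta>)
      \<or> (cotangent_action \<mu> ^^ k) (w, \<eta>) = (z, \<xi>)"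
    by (auto simp: cotangent_rel_def orbit_rel_def)
  then show ?thesis
  proof
    assume "(cotangent_action \<mu> ^^ k) (z, \<xi>) = (w, \<eta>)"
    then show ?thesis
      using \<mu> by (intro exI[of _ "int k"]) (auto simp: cotangent_action_iterate)
  next
    assume "(cotangent_action \<mu> ^^ k) (w, \<eta>) = (z, \<xi>)"
    then show ?thesis
      using \<mu> by (intro exI[of _ "- int k"])
        (auto simp: cotangent_action_iterate power_int_minus field_simps)
  qed
qed

text \<open>
  An embedding is linear on fibres, so it is determined by the images of the points \<open>(z, 1)\<close>; that these
  are nonzero is its injectivity.
\<close>

lemma
  fixes \<mu> :: "'n::finite \<Rightarrow> complex"
  assumes \<mu>: "hopf_multipliers \<mu>" and \<Phi>: "bundle_embedding \<mu> b \<Phi>" and z: "z \<in> punctured_space"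
  shows embedding_eq_pullback:
      "\<Phi> (line_rel \<mu> b `` {(z, v)}) = cotangent_rel \<mu> `` {(z, v *s pullback_coeffs \<mu> b \<Phi> z)}"
    and pullback_coeffs_nonzero: "pullback_coeffs \<mu> b \<Phi> z \<noteq> 0"
proof -
  define x where "x = orbit_rel punctured_space (contraction \<mu>) `` {z}"
  have "x \<in> hopf_manifold \<mu>" unfolding hopf_manifold_def x_def by (rule quotientI[OF z])
  moreover have "z \<in> x" using z by (auto simp: x_def orbit_rel_def intro: exI[of _ 0])
  ultimately obtain \<phi> where \<phi>: "Vector_Spaces.linear (*) (*s) \<phi>" "inj \<phi>"
    "\<And>v. \<Phi> (line_rel \<mu> b `` {(z, v)}) = cotangent_rel \<mu> `` {(z, \<phi> v)}"
    using \<Phi> unfolding bundle_embedding_def by metis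
  have \<phi>_scale: "\<phi> v = v *s \<phi> 1" for v
    using \<phi>(1) unfolding Vector_Spaces.linear_iff by (metis mult.right_neutral)
  have "pullback_coeffs \<mu> b \<Phi> z = \<phi> 1"
    unfolding pullback_coeffs_def
  proof (rule the_equality)
    show "\<Phi> (line_rel \<mu> b `` {(z, 1)}) = cotangent_rel \<mu> `` {(z, \<phi> 1)}" by (rule \<phi>(3))
    show "\<xi> = \<phi> 1" if "\<Phi> (line_rel \<mu> b `` {(z, 1)}) = cotangent_rel \<mu> `` {(z, \<xi>)}" for \<xi>
      using cotangent_class_unique[OF \<mu> z] that \<phi>(3) by metis
  qed
  then show "\<Phi> (line_rel \<mu> b `` {(z, v)}) = cotangent_rel \<mu> `` {(z, v *s pullback_coeffs \<mu> b \<Phi> z)}"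
    by (simp only: \<phi>(3) flip: \<phi>_scale)
  have "\<phi> 1 \<noteq> \<phi> 0" using \<phi>(2) by (simp add: inj_eq)
  then show "pullback_coeffs \<mu> b \<Phi> z \<noteq> 0"
    using \<open>pullback_coeffs \<mu> b \<Phi> z = \<phi> 1\<close> \<phi>_scale[of 0] by simp
qed

text \<open>
  The points \<open>(z, 1)\<close> and \<open>(f z, b)\<close> of the trivial bundle are identified in \<open>L_b\<close>; comparing the images of
  both in the cotangent bundle gives \<open>b * w (f z) $ i = w z $ i / \<mu> i\<close>.
\<close>

lemma semi_invariant_pullback_coeffs:
  fixes \<mu> :: "'n::finite \<Rightarrow> complex"
  assumes \<mu>: "hopf_multipliers \<mu>" and b: "b \<noteq> 0" and \<Phi>: "bundle_embedding \<mu> b \<Phi>"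
  shows "semi_invariant \<mu> (1 / b / \<mu> i) (\<lambda>z. pullback_coeffs \<mu> b \<Phi> z $ i)"
  unfolding semi_invariant_def
proof
  fix z :: "complex^'n" assume z: "z \<in> punctured_space"
  note \<mu>0 = hopf_multipliers_nonzero[OF \<mu>]
  let ?w = "pullback_coeffs \<mu> b \<Phi>" and ?f = "contraction \<mu>"
  have fz: "?f z \<in> punctured_space" by (rule contraction_mem_punctured_space[OF \<mu>0 z])
  have "cotangent_rel \<mu> `` {(?f z, b *s ?w (?f z))} = \<Phi> (line_rel \<mu> b `` {(?f z, b)})"
    by (rule embedding_eq_pullback[OF \<mu> \<Phi> fz, symmetric])
  also have "line_rel \<mu> b `` {(?f z, b)} = line_rel \<mu> b `` {(z, 1)}"
    using orbit_rel_class_step[OF bij_betw_line_action[OF \<mu>0 b], of "(z, 1)"] z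
    by (simp add: line_rel_def line_action_def)
  also have "\<Phi> \<dots> = cotangent_rel \<mu> `` {(z, ?w z)}"
    using embedding_eq_pullback[OF \<mu> \<Phi> z, of 1] by simp
  also have "\<dots> = cotangent_rel \<mu> `` {(?f z, \<chi> i. ?w z $ i / \<mu> i)}"
    using orbit_rel_class_step[OF bij_betw_cotangent_action[OF \<mu>0], of "(z, ?w z)"] z
    by (simp add: cotangent_rel_def cotangent_action_def)
  finally have "b *s ?w (?f z) = (\<chi> i. ?w z $ i / \<mu> i)"
    by (rule cotangent_class_unique[OF \<mu> fz])
  then have "b * ?w (?f z) $ i = ?w z $ i / \<mu> i" by (simp add: vec_eq_iff)
  then show "?w (?f z) $ i = 1 / b / \<mu> i * ?w z $ i"
    using b \<mu>0 by (simp add: field_simps)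
qed

lemma powi_near_1_imp_exponent_0:
  fixes m :: real
  assumes m: "0 < m" "m < 1" and l: "m < m powi l" "m powi l < 1 / m"
  shows "l = 0"
proof (rule ccontr)
  assume "l \<noteq> 0"
  then consider "l \<ge> 1" | "l \<le> -1" by linarith
  then show False
  proof cases
    case 1
    then have "m powi l \<le> m powi 1" using m by (intro power_int_decreasing) auto
    with l show False by simp
  next
    case 2
    then have "m powi (-1) \<le> m powi l" using m by (intro power_int_decreasing) auto
    with l show False by (simp add: power_int_minus divide_inverse)
  qed
qed

text \<open>
  A local holomorphic lift \<open>h\<close> represents the same cotangent class as \<open>(z, w z)\<close>, but possibly over another
  point \<open>f^k z\<close> of the orbit, with \<open>k\<close> depending on \<open>z\<close>. This \<open>k\<close> is locally constant: for a coordinate with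
  \<open>z0 $ l \<noteq> 0\<close> the quotient of the \<open>l\<close>-th coordinates of the base point of \<open>h (z, 1)\<close> and of \<open>z\<close> is continuous,
  and its values \<open>\<mu> l powi k\<close> form a discrete set. So near \<open>z0\<close> the \<open>i\<close>-th coefficient is
  that of \<open>h (z, 1)\<close> up to a constant factor.
\<close>

lemma holomorphic_map_pullback_coeffs:
  fixes \<mu> :: "'n::finite \<Rightarrow> complex"
  assumes \<mu>: "hopf_multipliers \<mu>" and \<Phi>: "bundle_embedding \<mu> b \<Phi>"
  shows "holomorphic_map (*s) (*) punctured_space (\<lambda>z. pullback_coeffs \<mu> b \<Phi> z $ i)"
  unfolding holomorphic_map_def
proof
  fix z0 :: "complex^'n" assume z0: "z0 \<in> punctured_space"
  note \<mu>0 = hopf_multipliers_nonzero[OF \<mu>]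
  let ?w = "pullback_coeffs \<mu> b \<Phi>"
  have "\<forall>p\<in>punctured_space \<times> UNIV. \<exists>U h.
      open U \<and> p \<in> U \<and> U \<subseteq> punctured_space \<times> UNIV \<and> h ` U \<subseteq> punctured_space \<times> UNIV \<and>
      holomorphic_map scale_line scale_cotangent U h \<and>
      (\<forall>q\<in>U. \<Phi> (line_rel \<mu> b `` {q}) = cotangent_rel \<mu> `` {h q})"
    using \<Phi> unfolding bundle_embedding_def holomorphic_bundle_map_def by blast
  from bspec[OF this, of "(z0, 1)"] obtain U h where U: "open U" "(z0, 1) \<in> U"
    "U \<subseteq> punctured_space \<times> UNIV" "h ` U \<subseteq> punctured_space \<times> UNIV"
    and h: "holomorphic_map scale_line scale_cotangent U h"
    and lift: "\<And>q. q \<in> U \<Longrightarrow> \<Phi> (line_rel \<mu> b `` {q}) = cotangent_rel \<mu> `` {h q}"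
    using z0 by (auto simp: Bex_def)
  from h U(2) obtain D where D: "(h has_derivative D) (at (z0, 1))"
    and D_lin: "Vector_Spaces.linear scale_line scale_cotangent D"
    by (auto simp: holomorphic_map_def)
  define V where "V = {z. (z, 1::complex) \<in> U}"
  have V: "open V" "z0 \<in> V"
  proof -
    have "open ((\<lambda>z. (z, 1::complex)) -` U)" by (intro open_vimage U continuous_intros)
    then show "open V" by (simp add: V_def vimage_def)
  qed (use U in \<open>simp add: V_def\<close>)
  have V_sub: "z \<in> punctured_space" if "z \<in> V" for z
    using that U(3) by (auto simp: V_def)
  have shift: "\<exists>k::int. \<forall>j. fst (h (z, 1)) $ j = \<mu> j powi k * z $ j \<and>
      ?w z $ j = \<mu> j powi k * snd (h (z, 1)) $ j" if z: "z \<in> V" for z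
  proof (rule cotangent_class_eqD[OF \<mu>0 V_sub[OF z]])
    show "fst (h (z, 1)) \<in> punctured_space" using z U(4) by (auto simp: V_def)
    have "cotangent_rel \<mu> `` {(z, ?w z)} = \<Phi> (line_rel \<mu> b `` {(z, 1)})"
      using embedding_eq_pullback[OF \<mu> \<Phi> V_sub[OF z], of 1] by simp
    also have "\<dots> = cotangent_rel \<mu> `` {h (z, 1)}" using lift z by (simp add: V_def)
    finally show "cotangent_rel \<mu> `` {(z, ?w z)} =
        cotangent_rel \<mu> `` {(fst (h (z, 1)), snd (h (z, 1)))}" by simp
  qed
  then obtain k where k: "\<And>z j. z \<in> V \<Longrightarrow> fst (h (z, 1)) $ j = \<mu> j powi k z * z $ j"
    "\<And>z j. z \<in> V \<Longrightarrow> ?w z $ j = \<mu> j powi k z * snd (h (z, 1)) $ j" by metis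
  have h1: "((\<lambda>z. h (z, 1)) has_derivative (\<lambda>v. D (v, 0))) (at z0)"
  proof -
    have "((\<lambda>z. (z, 1::complex)) has_derivative (\<lambda>v. (v, 0))) (at z0)"
      by (auto intro!: derivative_eq_intros)
    from has_derivative_compose[OF this, of h D] D show ?thesis by simp
  qed
  obtain l where l: "z0 $ l \<noteq> 0" using z0 by (auto simp: mem_punctured_space_iff)
  define m where "m = norm (\<mu> l)"
  have m: "0 < m" "m < 1" using \<mu> by (auto simp: m_def hopf_multipliers_def)
  \<comment> \<open>near \<open>z0\<close> this is \<open>m powi (k z - k z0)\<close>, and it tends to \<open>1\<close> at \<open>z0\<close>\<close>
  define q where "q = (\<lambda>z. norm (fst (h (z, 1)) $ l / z $ l / \<mu> l powi k z0))"
  have "isCont (\<lambda>z. h (z, 1)) z0" using h1 by (rule has_derivative_continuous)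
  then have "isCont q z0" unfolding q_def using l \<mu>0 by (intro continuous_intros) auto
  moreover have "q z0 = 1" using k(1)[OF V(2), of l] l \<mu>0 by (simp add: q_def)
  ultimately have lim: "(q \<longlongrightarrow> 1) (at z0)" by (simp add: isCont_def)
  have "\<forall>\<^sub>F z in at z0. m < q z" "\<forall>\<^sub>F z in at z0. q z < 1 / m"
    using order_tendstoD[OF lim] m by auto
  moreover have "\<forall>\<^sub>F z in at z0. z \<in> V" using V by (rule eventually_at_in_open')
  moreover have "\<forall>\<^sub>F z in at z0. z $ l \<noteq> 0"
  proof -
    have "((\<lambda>z. z $ l) \<longlongrightarrow> z0 $ l) (at z0)" by (intro tendsto_intros)
    then show ?thesis using l by (rule tendsto_imp_eventually_ne)
  qed
  ultimately have near: "\<forall>\<^sub>F z in at z0. \<mu> i powi k z0 * snd (h (z, 1)) $ i = ?w z $ i"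
  proof eventually_elim
    case (elim z)
    have "q z = m powi (k z - k z0)"
      using elim k(1)[of z l] \<mu>0 m
      by (simp add: q_def m_def norm_divide norm_mult norm_power_int power_int_diff)
    then have "k z - k z0 = 0"
      using powi_near_1_imp_exponent_0[OF m, of "k z - k z0"] elim by simp
    then show ?case using k(2)[of z i] elim by simp
  qed
  have "((\<lambda>z. \<mu> i powi k z0 * snd (h (z, 1)) $ i) has_derivative
      (\<lambda>v. \<mu> i powi k z0 * snd (D (v, 0)) $ i)) (at z0)"
    by (rule has_derivative_mult_right
      [OF bounded_linear.has_derivative[OF bounded_linear_vec_nth has_derivative_snd[OF h1]]])
  then have der: "((\<lambda>z. ?w z $ i) has_derivative (\<lambda>v. \<mu> i powi k z0 * snd (D (v, 0)) $ i)) (at z0)"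
    by (rule has_derivative_transform_eventually[OF _ near k(2)[OF V(2), symmetric]]) simp
  have "module_prod (*s) ((*) :: complex \<Rightarrow> complex \<Rightarrow> complex)"
    "module_prod ((*s) :: complex \<Rightarrow> complex^'n \<Rightarrow> complex^'n) ((*s) :: complex \<Rightarrow> complex^'n \<Rightarrow> complex^'n)"
    by (simp_all add: module_prod_def module_pair_def vec.module_axioms
        vector_space_over_itself.module_axioms)
  note scale = this[THEN module_prod.scale_def]
  have D_add: "D (x + y) = D x + D y" and D_scale: "D (scale_line a x) = scale_cotangent a (D x)"
    for x y a using D_lin unfolding Vector_Spaces.linear_iff by blast+
  have "D (a *s v, 0) = (a *s fst (D (v, 0)), a *s snd (D (v, 0)))" for a v
    using D_scale[of a "(v, 0)"] by (simp add: scale)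
  moreover have "D (u + v, 0) = D (u, 0) + D (v, 0)" for u v
    using D_add[of "(u, 0)" "(v, 0)"] by simp
  ultimately have "Vector_Spaces.linear (*s) (*) (\<lambda>v. \<mu> i powi k z0 * snd (D (v, 0)) $ i)"
    unfolding Vector_Spaces.linear_iff
    by (auto simp: vec.vector_space_axioms vector_space_over_itself.vector_space_axioms algebra_simps)
  with der show "\<exists>D. ((\<lambda>z. ?w z $ i) has_derivative D) (at z0) \<and> Vector_Spaces.linear (*s) (*) D"
    by blast
qed

lemma line_has_field_derivative:
  fixes G :: "complex^'n::finite \<Rightarrow> complex"
  assumes D: "(G has_derivative D) (at (z + \<zeta> *s u))" and lin: "Vector_Spaces.linear (*s) (*) D"
  shows "((\<lambda>\<zeta>. G (z + \<zeta> *s u)) has_field_derivative D u) (at \<zeta>)"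
proof -
  have scale: "bounded_linear (\<lambda>\<zeta>. \<zeta> *s u)"
  proof (rule bounded_linear_intro[where K = "norm u"])
    show "(r *\<^sub>R x) *s u = r *\<^sub>R (x *s u)" for r x
      by (simp add: vec_eq_iff)
  qed (simp_all add: vector_sadd_rdistrib norm_vector_scale)
  have "((\<lambda>\<zeta>. z + \<zeta> *s u) has_derivative (\<lambda>\<zeta>. 0 + \<zeta> *s u)) (at \<zeta>)"
    by (intro has_derivative_add has_derivative_const bounded_linear_imp_has_derivative[OF scale])
  from has_derivative_compose[OF this D]
  have "((\<lambda>\<zeta>. G (z + \<zeta> *s u)) has_derivative (\<lambda>\<zeta>. D (\<zeta> *s u))) (at \<zeta>)" by simp
  moreover have "(\<lambda>\<zeta>. D (\<zeta> *s u)) = (*) (D u)"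
    using lin unfolding Vector_Spaces.linear_iff by (auto simp: mult.commute)
  ultimately show ?thesis by (simp add: has_field_derivative_def)
qed

lemma holomorphic_map_imp_holomorphic_on_lines:
  fixes G :: "complex^'n::finite \<Rightarrow> complex"
  assumes G: "holomorphic_map (*s) (*) U G"
  shows "holomorphic_on_lines U G"
  unfolding holomorphic_on_lines_def
proof (intro conjI allI)
  show "continuous_on U G"
    using G by (intro continuous_at_imp_continuous_on)
      (auto simp: holomorphic_map_def dest: has_derivative_continuous)
  show "(\<lambda>\<zeta>. G (z + \<zeta> *s u)) holomorphic_on {\<zeta>. z + \<zeta> *s u \<in> U}" for z u
    unfolding holomorphic_on_def
  proof
    fix \<zeta> assume "\<zeta> \<in> {\<zeta>. z + \<zeta> *s u \<in> U}"
    then obtain D where D: "(G has_derivative D) (at (z + \<zeta> *s u))" "Vector_Spaces.linear (*s) (*) D"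
      using G by (auto simp: holomorphic_map_def)
    from line_has_field_derivative[OF this]
    show "(\<lambda>\<zeta>. G (z + \<zeta> *s u)) field_differentiable at \<zeta> within {\<zeta>. z + \<zeta> *s u \<in> U}"
      by (meson field_differentiable_def field_differentiable_at_within)
  qed
qed

lemma dir_deriv_eq_has_derivative:
  fixes G :: "complex^'n::finite \<Rightarrow> complex"
  assumes "(G has_derivative D) (at z)" "Vector_Spaces.linear (*s) (*) D"
  shows "dir_deriv u G z = D u"
  unfolding dir_deriv_def
  using line_has_field_derivative[of G D z 0 u] assms by (intro DERIV_imp_deriv) simp

section \<open>Integrability\<close>

text \<open>
  The partial derivatives determine the full derivative because it is complex linear; once they
  vanish, every coefficient function \<open>x \<mapsto> \<omega> x v\<close> of the form has derivative \<open>0\<close>.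
\<close>

lemma has_derivative_form_of_coeffs_0:
  fixes w :: "complex^'n::finite \<Rightarrow> complex^'n"
  assumes hol: "\<And>i. holomorphic_map (*s) (*) U (\<lambda>x. w x $ i)" and z: "z \<in> U"
    and partial: "\<And>i j. dir_deriv (axis j 1) (\<lambda>x. w x $ i) z = 0"
  shows "((\<lambda>x. form_of_coeffs w x v) has_derivative (\<lambda>_. 0)) (at z)"
proof -
  have der: "((\<lambda>x. w x $ i) has_derivative (\<lambda>_. 0)) (at z)" for i
  proof -
    obtain D where D: "((\<lambda>x. w x $ i) has_derivative D) (at z)" "Vector_Spaces.linear (*s) (*) D"
      using hol z by (auto simp: holomorphic_map_def)
    interpret D: Vector_Spaces.linear "(*s)" "(*)" D by (rule D(2))
    have D_axis: "D (axis j 1) = 0" for j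
      using partial[of j i] unfolding dir_deriv_eq_has_derivative[OF D] .
    have "D u = 0" for u
    proof -
      have "D u = D (\<Sum>j\<in>UNIV. (u $ j) *s axis j 1)" by (simp only: basis_expansion)
      also have "\<dots> = (\<Sum>j\<in>UNIV. u $ j * D (axis j 1))" by (simp add: D.sum D.scale)
      also have "\<dots> = 0" by (simp add: D_axis)
      finally show ?thesis .
    qed
    then have "D = (\<lambda>_. 0)" by (rule ext)
    with D(1) show ?thesis by simp
  qed
  have "((\<lambda>x. \<Sum>i\<in>UNIV. w x $ i * v $ i) has_derivative (\<lambda>u. \<Sum>i\<in>UNIV. 0 * v $ i)) (at z)"
    by (intro has_derivative_sum has_derivative_mult_left der)
  then show ?thesis by (simp add: form_of_coeffs_def)
qed

theorem corollary1p7: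
  fixes \<mu> :: "'n::{finite,linorder} \<Rightarrow> complex"
    and b :: complex
    and \<Phi> :: "((complex^'n::{finite,linorder}) \<times> complex) set
      \<Rightarrow> ((complex^'n::{finite,linorder}) \<times> (complex^'n::{finite,linorder})) set"
  assumes "CARD('n) \<ge> 3"
    and "hopf_multipliers \<mu>"
    and "intermediary \<mu> \<or> generic \<mu>"
    and "nonsingular_distribution \<mu> b \<Phi>"
  shows "integrable_distribution \<mu> b \<Phi>"
proof -
  note \<mu> = assms(2)
  note \<mu>0 = hopf_multipliers_nonzero[OF \<mu>]
  have b: "b \<noteq> 0" and \<Phi>: "bundle_embedding \<mu> b \<Phi>"
    using assms(4) by (simp_all add: nonsingular_distribution_def)
  obtain B where B: "independent_values \<mu>" "single_block \<mu> B"
    using assms(3) generic_imp_single_block[OF _ \<mu>0] intermediary_imp_single_block[OF _ \<mu>0] by blast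
  let ?w = "pullback_coeffs \<mu> b \<Phi>"
  note hol = holomorphic_map_pullback_coeffs[OF \<mu> \<Phi>]
  have partial: "dir_deriv (axis j 1) (\<lambda>x. ?w x $ i) z = 0" if "z \<in> punctured_space" for i j z
  proof (rule semi_invariant_coefficients_locally_constant[OF assms(1) \<mu> B, where c = "1 / b"])
    show "\<exists>i. ?w x $ i \<noteq> 0" if "x \<in> punctured_space" for x
      using pullback_coeffs_nonzero[OF \<mu> \<Phi> that] by (simp add: vec_eq_iff)
    show "holomorphic_on_lines punctured_space (\<lambda>x. ?w x $ i)" for i
      by (rule holomorphic_map_imp_holomorphic_on_lines[OF hol])
    show "semi_invariant \<mu> (1 / b / \<mu> i) (\<lambda>x. ?w x $ i)" for i
      by (rule semi_invariant_pullback_coeffs[OF \<mu> b \<Phi>])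
  qed (use b that in auto)
  have "ext_deriv (form_of_coeffs ?w) z u v = 0" if "z \<in> punctured_space" for z u v
  proof -
    have "frechet_derivative (\<lambda>x. form_of_coeffs ?w x v) (at z) = (\<lambda>_. 0)" for v
      by (rule frechet_derivative_at[symmetric])
        (rule has_derivative_form_of_coeffs_0[OF hol that partial[OF that]])
    then show ?thesis by (simp add: ext_deriv_def)
  qed
  then show ?thesis
    by (simp add: integrable_distribution_def wedge_1_2_def)
qed

end
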